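(* Let $E=(E^0,E^1,r,s)$ be a directed graph, let $\beta>0$, and let $c:E^1\to(0,\infty)$ be a function for which there is a constant $k>0$ with $c(e)>k$ for all $e\in E^1$; extend $c$ multiplicatively to $E^*$ and let $\sigma$ be the associated one-parameter automorphism group of $C^*(E)$. Suppose $c(\mu)\neq 1$ for all $\mu\in E^*\setminus E^0$. If $\varphi$ is a $(\sigma,\beta)$-KMS state on $C^*(E)$, then its restriction $\omega=\varphi|_{C^*(E)^{\gamma}}$ to the core satisfies $$\omega(s_{\mu}s_{\nu}^* )=[\mu=\nu]\,c(\mu)^{-\beta}\,\omega(p_{s(\mu)})\qquad(\ast)$$ for all paths $\mu,\nu\in E^*$ with $|\mu|=|\nu|$ and $s(\mu)=s(\nu)$. Conversely, if $\omega$ is a state on $C^*(E)^{\gamma}$ satisfying $(\ast)$ for all such $\mu,\nu$, then $\varphi=\omega\circ\Phi$ is a $(\sigma,\beta)$-KMS state on $C^*(E)$, where $\Phi:C^*(E)\to C^*(E)^{\gamma}$ is the conditional expectation with $\Phi(s_\mu s_\nu^* )=[|\mu|=|\nu|]\,s_\mu s_\nu^*$. The correspondence thus obtained between $(\sigma,\beta)$-KMS states on $C^*(E)$ and states on $C^*(E)^\gamma$ satisfying $(\ast)$ is bijective and preserves convex combinations.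
   Context: A directed graph $E=(E^0,E^1,r,s)$ consists of nonempty sets $E^0$ (vertices), $E^1$ (edges) and functions $r,s:E^1\to E^0$ (range, source); no countability or finiteness is assumed. A path of length $n\ge1$ is a sequence $\mu=\mu_1\cdots\mu_n$ of edges with $r(\mu_{i+1})=s(\mu_i)$ for $1\le i\le n-1$; $|\mu|=n$, $s(\mu)=s(\mu_n)$, $r(\mu)=r(\mu_1)$. Vertices are paths of length $0$, with $s(v)=v=r(v)$. $E^n$ is the set of paths of length $n$ and $E^*=\bigcup_{n\ge0}E^n$. $C^*(E)$ is the universal C*-algebra generated by mutually orthogonal projections $\{p_v\}_{v\in E^0}$ and partial isometries $\{s_e\}_{e\in E^1}$ with mutually orthogonal ranges such that (1) $s_e^*s_e=p_{s(e)}$; (2) $s_es_e^*\le p_{r(e)}$ for every $e\in E^1$; (3) $p_v=\sum_{e\in r^{-1}(v)}s_es_e^*$ whenever $0<|r^{-1}(v)|<\infty$. For $\mu=\mu_1\cdots\mu_n$, $s_\mu=s_{\mu_1}\cdots s_{\mu_n}$, and $s_v=p_v$ for $v\in E^0$. One has $C^*(E)=\overline{\mathrm{span}}\{s_\mu s_\nu^*:\mu,\nu\in E^*,\ s(\mu)=s(\nu)\}$. The gauge action $\gamma$ of $\mathbb T$ on $C^*(E)$ is given by $\gamma_z(s_e)=zs_e$, $\gamma_z(p_v)=p_v$. The core $C^*(E)^\gamma$ is its fixed-point algebra; it equals $\overline{\mathrm{span}}\{s_\mu s_\nu^*:s(\mu)=s(\nu),|\mu|=|\nu|\}$. There is a conditional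 expectation $\Phi:C^*(E)\to C^*(E)^\gamma$ with the formula given in the claim. The function $c$ is extended to $E^*$ by $c(v)=1$ for $v\in E^0$ and $c(\mu)=c(\mu_1)\cdots c(\mu_n)$ for $\mu=\mu_1\cdots\mu_n\in E^n$. The strongly continuous action $\sigma=\sigma^c:\mathbb R\to\mathrm{Aut}(C^*(E))$ is given by $\sigma_t(p_v)=p_v$ and $\sigma_t(s_e)=c(e)^{it}s_e$. A state $\varphi$ is a $(\sigma,\beta)$-KMS state if $\varphi(xy)=\varphi(y\,\sigma_{i\beta}(x))$ for all $x,y$ in a norm-dense $\sigma$-invariant *-subalgebra of entire analytic elements for $\sigma$ (for instance the span of the $s_\mu s_\nu^*$, on which $\sigma_{i\beta}(s_\mu s_\nu^* )=c(\mu)^{-\beta}c(\nu)^{\beta}s_\mu s_\nu^*$). $[P]$ equals $1$ if $P$ is true and $0$ otherwise. *)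

theory Defs
  imports "HOL-Analysis.Analysis" "Graph_Theory.Digraph"
begin

section \<open>C*-algebras\<close>

text \<open>Complex C*-algebras, not necessarily unital, as a type class on top of the real Banach
  algebras of the library.\<close>

class cstar_algebra = real_normed_algebra + banach +
  fixes scaleC :: "complex \<Rightarrow> 'a \<Rightarrow> 'a" (infixr "*\<^sub>C" 75)
    and adj :: "'a \<Rightarrow> 'a"
  assumes scaleC_add_right: "a *\<^sub>C (x + y) = a *\<^sub>C x + a *\<^sub>C y"
    and scaleC_add_left: "(a + b) *\<^sub>C x = a *\<^sub>C x + b *\<^sub>C x"
    and scaleC_scaleC: "a *\<^sub>C (b *\<^sub>C x) = (a * b) *\<^sub>C x"
    and scaleR_scaleC: "scaleR r x = complex_of_real r *\<^sub>C x"
    and mult_scaleC_left: "(a *\<^sub>C x) * y = a *\<^sub>C (x * y)"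
    and mult_scaleC_right: "x * (a *\<^sub>C y) = a *\<^sub>C (x * y)"
    and norm_scaleC: "norm (a *\<^sub>C x) = cmod a * norm x"
    and adj_add: "adj (x + y) = adj x + adj y"
    and adj_scaleC: "adj (a *\<^sub>C x) = cnj a *\<^sub>C adj x"
    and adj_mult: "adj (x * y) = adj y * adj x"
    and adj_adj: "adj (adj x) = x"
    and cstar_identity: "norm (adj x * x) = (norm x)\<^sup>2"

text \<open>C*-algebras as set-based structures. These are needed because the universal property
  defining a graph C*-algebra quantifies over C*-algebras inside a formula, which cannot be done
  with the type class.\<close>

record 'b cstar_struct =
  Carr :: "'b set"
  Zero :: 'b
  Add :: "'b \<Rightarrow> 'b \<Rightarrow> 'b"
  Mult :: "'b \<Rightarrow> 'b \<Rightarrow> 'b"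
  Scale :: "complex \<Rightarrow> 'b \<Rightarrow> 'b"
  Adj :: "'b \<Rightarrow> 'b"
  Norm :: "'b \<Rightarrow> real"

locale cstar_alg =
  fixes B :: "'b cstar_struct"
  assumes Zero_closed: "Zero B \<in> Carr B"
    and Add_closed: "\<lbrakk>x \<in> Carr B; y \<in> Carr B\<rbrakk> \<Longrightarrow> Add B x y \<in> Carr B"
    and Mult_closed: "\<lbrakk>x \<in> Carr B; y \<in> Carr B\<rbrakk> \<Longrightarrow> Mult B x y \<in> Carr B"
    and Scale_closed: "x \<in> Carr B \<Longrightarrow> Scale B a x \<in> Carr B"
    and Adj_closed: "x \<in> Carr B \<Longrightarrow> Adj B x \<in> Carr B"
    and Add_assoc: "\<lbrakk>x \<in> Carr B; y \<in> Carr B; z \<in> Carr B\<rbrakk> \<Longrightarrow>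
          Add B (Add B x y) z = Add B x (Add B y z)"
    and Add_commute: "\<lbrakk>x \<in> Carr B; y \<in> Carr B\<rbrakk> \<Longrightarrow> Add B x y = Add B y x"
    and Add_Zero: "x \<in> Carr B \<Longrightarrow> Add B (Zero B) x = x"
    and Add_inverse: "x \<in> Carr B \<Longrightarrow> Add B (Scale B (-1) x) x = Zero B"
    and Scale_Add_right: "\<lbrakk>x \<in> Carr B; y \<in> Carr B\<rbrakk> \<Longrightarrow>
          Scale B a (Add B x y) = Add B (Scale B a x) (Scale B a y)"
    and Scale_Add_left: "x \<in> Carr B \<Longrightarrow> Scale B (a + b) x = Add B (Scale B a x) (Scale B b x)"
    and Scale_Scale: "x \<in> Carr B \<Longrightarrow> Scale B a (Scale B b x) = Scale B (a * b) x"
    and Scale_one: "x \<in> Carr B \<Longrightarrow> Scale B 1 x = x"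
    and Mult_assoc: "\<lbrakk>x \<in> Carr B; y \<in> Carr B; z \<in> Carr B\<rbrakk> \<Longrightarrow>
          Mult B (Mult B x y) z = Mult B x (Mult B y z)"
    and Mult_Add_left: "\<lbrakk>x \<in> Carr B; y \<in> Carr B; z \<in> Carr B\<rbrakk> \<Longrightarrow>
          Mult B (Add B x y) z = Add B (Mult B x z) (Mult B y z)"
    and Mult_Add_right: "\<lbrakk>x \<in> Carr B; y \<in> Carr B; z \<in> Carr B\<rbrakk> \<Longrightarrow>
          Mult B x (Add B y z) = Add B (Mult B x y) (Mult B x z)"
    and Mult_Scale_left: "\<lbrakk>x \<in> Carr B; y \<in> Carr B\<rbrakk> \<Longrightarrow>
          Mult B (Scale B a x) y = Scale B a (Mult B x y)"
    and Mult_Scale_right: "\<lbrakk>x \<in> Carr B; y \<in> Carr B\<rbrakk> \<Longrightarrow>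
          Mult B x (Scale B a y) = Scale B a (Mult B x y)"
    and Adj_Add: "\<lbrakk>x \<in> Carr B; y \<in> Carr B\<rbrakk> \<Longrightarrow> Adj B (Add B x y) = Add B (Adj B x) (Adj B y)"
    and Adj_Scale: "x \<in> Carr B \<Longrightarrow> Adj B (Scale B a x) = Scale B (cnj a) (Adj B x)"
    and Adj_Mult: "\<lbrakk>x \<in> Carr B; y \<in> Carr B\<rbrakk> \<Longrightarrow>
          Adj B (Mult B x y) = Mult B (Adj B y) (Adj B x)"
    and Adj_Adj: "x \<in> Carr B \<Longrightarrow> Adj B (Adj B x) = x"
    and Norm_eq_zero: "x \<in> Carr B \<Longrightarrow> Norm B x = 0 \<longleftrightarrow> x = Zero B"
    and Norm_triangle: "\<lbrakk>x \<in> Carr B; y \<in> Carr B\<rbrakk> \<Longrightarrow> Norm B (Add B x y) \<le> Norm B x + Norm B y"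
    and Norm_Scale: "x \<in> Carr B \<Longrightarrow> Norm B (Scale B a x) = cmod a * Norm B x"
    and Norm_Mult: "\<lbrakk>x \<in> Carr B; y \<in> Carr B\<rbrakk> \<Longrightarrow> Norm B (Mult B x y) \<le> Norm B x * Norm B y"
    and Norm_cstar: "x \<in> Carr B \<Longrightarrow> Norm B (Mult B (Adj B x) x) = (Norm B x)\<^sup>2"
    and complete: "Metric_space.mcomplete (Carr B) (\<lambda>x y. Norm B (Add B x (Scale B (-1) y)))"

definition type_cstar :: "'a::cstar_algebra cstar_struct" where
  "type_cstar = \<lparr>Carr = UNIV, Zero = 0, Add = (+), Mult = (*), Scale = (*\<^sub>C), Adj = adj, Norm = norm\<rparr>"

lemma scaleC_minus_one: "(-1) *\<^sub>C x = - (x :: 'a::cstar_algebra)"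
  using scaleR_scaleC[of "-1" x] by simp

text \<open>The two notions of C*-algebra agree.\<close>

lemma cstar_alg_type_cstar: "cstar_alg (type_cstar :: 'a::cstar_algebra cstar_struct)"
proof -
  have "dist = (\<lambda>x y :: 'a. norm (x - y))"
    by (intro ext) (simp add: dist_norm)
  then have c: "Metric_space.mcomplete UNIV (\<lambda>x y :: 'a. norm (x - y))"
    using mcomplete_iff_complete[where 'a = 'a] by (simp add: complete_UNIV)
  have one: "1 *\<^sub>C x = x" for x :: 'a
    using scaleR_scaleC[of 1 x] by simp
  show ?thesis
    unfolding cstar_alg_def type_cstar_def
    by (simp add: c one algebra_simps scaleC_add_right scaleC_add_left scaleC_scaleC
        scaleC_minus_one mult_scaleC_left mult_scaleC_right norm_scaleC adj_add adj_scaleC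
        adj_mult adj_adj cstar_identity norm_triangle_ineq norm_mult_ineq del: mcomplete_iff_complete)
qed

definition star_hom :: "'a cstar_struct \<Rightarrow> 'b cstar_struct \<Rightarrow> ('a \<Rightarrow> 'b) \<Rightarrow> bool" where
  "star_hom A B \<pi> \<longleftrightarrow>
     (\<forall>x\<in>Carr A. \<pi> x \<in> Carr B) \<and>
     (\<forall>x\<in>Carr A. \<forall>y\<in>Carr A. \<pi> (Add A x y) = Add B (\<pi> x) (\<pi> y)) \<and>
     (\<forall>a. \<forall>x\<in>Carr A. \<pi> (Scale A a x) = Scale B a (\<pi> x)) \<and>
     (\<forall>x\<in>Carr A. \<forall>y\<in>Carr A. \<pi> (Mult A x y) = Mult B (\<pi> x) (\<pi> y)) \<and>
     (\<forall>x\<in>Carr A. \<pi> (Adj A x) = Adj B (\<pi> x))"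

definition star_automorphism :: "('a::cstar_algebra \<Rightarrow> 'a) \<Rightarrow> bool" where
  "star_automorphism \<alpha> \<longleftrightarrow> star_hom type_cstar type_cstar \<alpha> \<and> bij \<alpha>"

definition projection :: "'b cstar_struct \<Rightarrow> 'b \<Rightarrow> bool" where
  "projection B p \<longleftrightarrow> p \<in> Carr B \<and> Adj B p = p \<and> Mult B p p = p"

definition partial_isometry :: "'b cstar_struct \<Rightarrow> 'b \<Rightarrow> bool" where
  "partial_isometry B s \<longleftrightarrow> s \<in> Carr B \<and> Mult B (Mult B s (Adj B s)) s = s"

text \<open>The usual order \<open>q \<le> p\<close> on projections (only used for projections).\<close>

definition proj_le :: "'b cstar_struct \<Rightarrow> 'b \<Rightarrow> 'b \<Rightarrow> bool" where
  "proj_le B q p \<longleftrightarrow> Mult B p q = q"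

definition star_subalgebra :: "'a::cstar_algebra set \<Rightarrow> bool" where
  "star_subalgebra S \<longleftrightarrow> 0 \<in> S \<and>
     (\<forall>x\<in>S. \<forall>y\<in>S. x + y \<in> S \<and> x * y \<in> S) \<and> (\<forall>x\<in>S. adj x \<in> S \<and> (\<forall>a. a *\<^sub>C x \<in> S))"

section \<open>Paths\<close>

text \<open>In a digraph of the library, \<open>tail\<close> is the source map and \<open>head\<close> the range map. Paths
  compose like operators: consecutive edges satisfy \<open>r(\<mu>\<^bsub>i+1\<^esub>) = s(\<mu>\<^bsub>i\<^esub>)\<close>, so these are not the
  \<open>awalk\<close>s of the library. \<open>Edges []\<close> is not a path; the paths of length \<open>0\<close> are the vertices.\<close>

datatype ('v, 'e) gpath = Vertex 'v | Edges "'e list"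

definition paths :: "('v, 'e) pre_digraph \<Rightarrow> ('v, 'e) gpath set" where
  "paths E = Vertex ` verts E \<union>
     Edges ` {es. es \<noteq> [] \<and> set es \<subseteq> arcs E \<and>
                  (\<forall>i. Suc i < length es \<longrightarrow> head E (es ! Suc i) = tail E (es ! i))}"

fun path_length :: "('v, 'e) gpath \<Rightarrow> nat" where
  "path_length (Vertex v) = 0"
| "path_length (Edges es) = length es"

fun path_source :: "('v, 'e) pre_digraph \<Rightarrow> ('v, 'e) gpath \<Rightarrow> 'v" where
  "path_source E (Vertex v) = v"
| "path_source E (Edges es) = tail E (last es)"

fun path_weight :: "('e \<Rightarrow> real) \<Rightarrow> ('v, 'e) gpath \<Rightarrow> real" where
  "path_weight c (Vertex v) = 1"
| "path_weight c (Edges es) = prod_list (map c es)"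

text \<open>Product of a nonempty list; there need not be a unit, and the value at \<open>[]\<close> is junk.\<close>

fun edge_prod :: "('e \<Rightarrow> 'a::cstar_algebra) \<Rightarrow> 'e list \<Rightarrow> 'a" where
  "edge_prod s [] = 0"
| "edge_prod s [e] = s e"
| "edge_prod s (e # f # es) = s e * edge_prod s (f # es)"

fun path_elt :: "('v \<Rightarrow> 'a::cstar_algebra) \<Rightarrow> ('e \<Rightarrow> 'a) \<Rightarrow> ('v, 'e) gpath \<Rightarrow> 'a" where
  "path_elt p s (Vertex v) = p v"
| "path_elt p s (Edges es) = edge_prod s es"

section \<open>Graph C*-algebras\<close>

text \<open>In the last clause an enumeration \<open>es\<close> of \<open>r\<^sup>-\<^sup>1(v)\<close> without repetition exists iff
  \<open>r\<^sup>-\<^sup>1(v)\<close> is finite, and \<open>es \<noteq> []\<close> says that it is nonempty.\<close>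

definition CK_family ::
  "('v, 'e) pre_digraph \<Rightarrow> 'b cstar_struct \<Rightarrow> ('v \<Rightarrow> 'b) \<Rightarrow> ('e \<Rightarrow> 'b) \<Rightarrow> bool" where
  "CK_family E B p s \<longleftrightarrow>
     (\<forall>v\<in>verts E. projection B (p v)) \<and>
     (\<forall>v\<in>verts E. \<forall>w\<in>verts E. v \<noteq> w \<longrightarrow> Mult B (p v) (p w) = Zero B) \<and>
     (\<forall>e\<in>arcs E. partial_isometry B (s e)) \<and>
     (\<forall>e\<in>arcs E. \<forall>f\<in>arcs E. e \<noteq> f \<longrightarrow>
        Mult B (Mult B (s e) (Adj B (s e))) (Mult B (s f) (Adj B (s f))) = Zero B) \<and>
     (\<forall>e\<in>arcs E. Mult B (Adj B (s e)) (s e) = p (tail E e)) \<and>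
     (\<forall>e\<in>arcs E. proj_le B (Mult B (s e) (Adj B (s e))) (p (head E e))) \<and>
     (\<forall>v\<in>verts E. \<forall>es. es \<noteq> [] \<and> distinct es \<and> set es = {e \<in> arcs E. head E e = v} \<longrightarrow>
        p v = foldr (\<lambda>e. Add B (Mult B (s e) (Adj B (s e)))) es (Zero B))"

text \<open>Sequences of noncommutative *-polynomials in the vertices and edges (a generator marked
  \<open>True\<close> is starred). Every element of a C*-algebra generated by a Cuntz--Krieger \<open>E\<close>-family is
  the limit of such a sequence evaluated at the family, so every such C*-algebra is isomorphic to
  one whose carrier is a set of elements of this type.\<close>

type_synonym ('v, 'e) ck_universe = "nat \<Rightarrow> (complex \<times> (('v + 'e) \<times> bool) list) list"

text \<open>\<open>(p, s)\<close> exhibits the C*-algebra \<open>'a\<close> as \<open>C*(E)\<close>: it is a Cuntz--Krieger \<open>E\<close>-family that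
  generates \<open>'a\<close> and is universal. By the preceding remark it is no restriction that the
  universal property only ranges over the C*-algebras carried by subsets of \<open>ck_universe\<close>.\<close>

definition graph_cstar_algebra ::
  "('v, 'e) pre_digraph \<Rightarrow> ('v \<Rightarrow> 'a::cstar_algebra) \<Rightarrow> ('e \<Rightarrow> 'a) \<Rightarrow> bool" where
  "graph_cstar_algebra E p s \<longleftrightarrow>
     CK_family E type_cstar p s \<and>
     (\<forall>S. star_subalgebra S \<and> closed S \<and> p ` verts E \<subseteq> S \<and> s ` arcs E \<subseteq> S \<longrightarrow> S = UNIV) \<and>
     (\<forall>(B :: ('v, 'e) ck_universe cstar_struct) q t. cstar_alg B \<and> CK_family E B q t \<longrightarrow>
        (\<exists>\<pi>. star_hom type_cstar B \<pi> \<and>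
             (\<forall>v\<in>verts E. \<pi> (p v) = q v) \<and> (\<forall>e\<in>arcs E. \<pi> (s e) = t e)))"

section \<open>Gauge action, core and dynamics\<close>

definition gauge_action ::
  "('v, 'e) pre_digraph \<Rightarrow> ('v \<Rightarrow> 'a::cstar_algebra) \<Rightarrow> ('e \<Rightarrow> 'a) \<Rightarrow> (complex \<Rightarrow> 'a \<Rightarrow> 'a) \<Rightarrow> bool" where
  "gauge_action E p s \<gamma> \<longleftrightarrow>
     (\<forall>z\<in>sphere 0 1. star_automorphism (\<gamma> z)) \<and>
     (\<forall>z\<in>sphere 0 1. \<forall>w\<in>sphere 0 1. \<gamma> (z * w) = \<gamma> z \<circ> \<gamma> w) \<and>
     (\<forall>x. continuous_on (sphere 0 1) (\<lambda>z. \<gamma> z x)) \<and>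
     (\<forall>z\<in>sphere 0 1. (\<forall>e\<in>arcs E. \<gamma> z (s e) = z *\<^sub>C s e) \<and> (\<forall>v\<in>verts E. \<gamma> z (p v) = p v))"

definition core :: "(complex \<Rightarrow> 'a::cstar_algebra \<Rightarrow> 'a) \<Rightarrow> 'a set" where
  "core \<gamma> = {x. \<forall>z\<in>sphere 0 1. \<gamma> z x = x}"

definition conditional_expectation :: "'a::cstar_algebra set \<Rightarrow> ('a \<Rightarrow> 'a) \<Rightarrow> bool" where
  "conditional_expectation S \<Phi> \<longleftrightarrow>
     (\<forall>x y. \<Phi> (x + y) = \<Phi> x + \<Phi> y) \<and> (\<forall>a x. \<Phi> (a *\<^sub>C x) = a *\<^sub>C \<Phi> x) \<and>
     (\<forall>x. \<Phi> x \<in> S) \<and> (\<forall>x\<in>S. \<Phi> x = x) \<and>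
     (\<forall>x. norm (\<Phi> x) \<le> norm x) \<and>
     (\<forall>x. \<exists>y\<in>S. \<Phi> (adj x * x) = adj y * y) \<and>
     (\<forall>x. \<forall>y\<in>S. \<Phi> (y * x) = y * \<Phi> x \<and> \<Phi> (x * y) = \<Phi> x * y)"

definition core_expectation ::
  "('v, 'e) pre_digraph \<Rightarrow> ('v \<Rightarrow> 'a::cstar_algebra) \<Rightarrow> ('e \<Rightarrow> 'a) \<Rightarrow> (complex \<Rightarrow> 'a \<Rightarrow> 'a) \<Rightarrow>
   ('a \<Rightarrow> 'a) \<Rightarrow> bool" where
  "core_expectation E p s \<gamma> \<Phi> \<longleftrightarrow>
     conditional_expectation (core \<gamma>) \<Phi> \<and>
     (\<forall>\<mu>\<in>paths E. \<forall>\<nu>\<in>paths E. path_source E \<mu> = path_source E \<nu> \<longrightarrow>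
        \<Phi> (path_elt p s \<mu> * adj (path_elt p s \<nu>)) =
          (if path_length \<mu> = path_length \<nu> then path_elt p s \<mu> * adj (path_elt p s \<nu>) else 0))"

definition weight_dynamics ::
  "('v, 'e) pre_digraph \<Rightarrow> ('v \<Rightarrow> 'a::cstar_algebra) \<Rightarrow> ('e \<Rightarrow> 'a) \<Rightarrow> ('e \<Rightarrow> real) \<Rightarrow>
   (real \<Rightarrow> 'a \<Rightarrow> 'a) \<Rightarrow> bool" where
  "weight_dynamics E p s c \<sigma> \<longleftrightarrow>
     (\<forall>t. star_automorphism (\<sigma> t)) \<and>
     (\<forall>t u. \<sigma> (t + u) = \<sigma> t \<circ> \<sigma> u) \<and>
     (\<forall>x. continuous_on UNIV (\<lambda>t. \<sigma> t x)) \<and>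
     (\<forall>t. (\<forall>v\<in>verts E. \<sigma> t (p v) = p v) \<and>
          (\<forall>e\<in>arcs E. \<sigma> t (s e) = (complex_of_real (c e) powr (\<i> * complex_of_real t)) *\<^sub>C s e))"

section \<open>States and KMS states\<close>

text \<open>States on the C*-subalgebra \<open>S\<close>; values outside \<open>S\<close> are irrelevant.\<close>

definition state_on :: "'a::cstar_algebra set \<Rightarrow> ('a \<Rightarrow> complex) \<Rightarrow> bool" where
  "state_on S \<phi> \<longleftrightarrow>
     (\<forall>x\<in>S. \<forall>y\<in>S. \<phi> (x + y) = \<phi> x + \<phi> y) \<and>
     (\<forall>a. \<forall>x\<in>S. \<phi> (a *\<^sub>C x) = a * \<phi> x) \<and>
     (\<forall>x\<in>S. \<phi> (adj x * x) \<in> \<real>\<^sub>\<ge>\<^sub>0) \<and>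
     bdd_above ((\<lambda>x. cmod (\<phi> x)) ` (S \<inter> cball 0 1)) \<and>
     (SUP x \<in> S \<inter> cball 0 1. cmod (\<phi> x)) = 1"

text \<open>The library's \<open>holomorphic_on\<close> needs values in a field.\<close>

definition entire :: "(complex \<Rightarrow> 'a::cstar_algebra) \<Rightarrow> bool" where
  "entire F \<longleftrightarrow> (\<forall>z. \<exists>D. ((\<lambda>w. inverse (w - z) *\<^sub>C (F w - F z)) \<longlongrightarrow> D) (at z))"

definition entire_extension ::
  "(real \<Rightarrow> 'a::cstar_algebra \<Rightarrow> 'a) \<Rightarrow> 'a \<Rightarrow> (complex \<Rightarrow> 'a) \<Rightarrow> bool" where
  "entire_extension \<sigma> x F \<longleftrightarrow> entire F \<and> (\<forall>t. F (complex_of_real t) = \<sigma> t x)"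

definition entire_analytic :: "(real \<Rightarrow> 'a::cstar_algebra \<Rightarrow> 'a) \<Rightarrow> 'a \<Rightarrow> bool" where
  "entire_analytic \<sigma> x \<longleftrightarrow> (\<exists>F. entire_extension \<sigma> x F)"

text \<open>\<open>\<sigma>\<^sub>z(x)\<close> for entire analytic \<open>x\<close>; by the identity theorem the extension is unique.\<close>

definition complex_flow :: "(real \<Rightarrow> 'a::cstar_algebra \<Rightarrow> 'a) \<Rightarrow> complex \<Rightarrow> 'a \<Rightarrow> 'a" where
  "complex_flow \<sigma> z x = (SOME F. entire_extension \<sigma> x F) z"

definition KMS_state :: "(real \<Rightarrow> 'a::cstar_algebra \<Rightarrow> 'a) \<Rightarrow> real \<Rightarrow> ('a \<Rightarrow> complex) \<Rightarrow> bool" where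
  "KMS_state \<sigma> \<beta> \<phi> \<longleftrightarrow>
     state_on UNIV \<phi> \<and>
     (\<exists>D. star_subalgebra D \<and> closure D = UNIV \<and> (\<forall>t. \<sigma> t ` D \<subseteq> D) \<and>
          (\<forall>x\<in>D. entire_analytic \<sigma> x) \<and>
          (\<forall>x\<in>D. \<forall>y\<in>D. \<phi> (x * y) = \<phi> (y * complex_flow \<sigma> (\<i> * complex_of_real \<beta>) x)))"

text \<open>The condition \<open>\<omega>(s\<^sub>\<mu> s\<^sub>\<nu>*) = [\<mu> = \<nu>] c(\<mu>)\<^sup>-\<^sup>\<beta> \<omega>(p\<^bsub>s(\<mu>)\<^esub>)\<close> for \<open>|\<mu>| = |\<nu>|\<close>, \<open>s(\<mu>) = s(\<nu>)\<close>.\<close>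

definition core_condition ::
  "('v, 'e) pre_digraph \<Rightarrow> ('v \<Rightarrow> 'a::cstar_algebra) \<Rightarrow> ('e \<Rightarrow> 'a) \<Rightarrow> ('e \<Rightarrow> real) \<Rightarrow> real \<Rightarrow>
   ('a \<Rightarrow> complex) \<Rightarrow> bool" where
  "core_condition E p s c \<beta> \<omega> \<longleftrightarrow>
     (\<forall>\<mu>\<in>paths E. \<forall>\<nu>\<in>paths E.
        path_length \<mu> = path_length \<nu> \<and> path_source E \<mu> = path_source E \<nu> \<longrightarrow>
        \<omega> (path_elt p s \<mu> * adj (path_elt p s \<nu>)) =
          (if \<mu> = \<nu>
           then complex_of_real (path_weight c \<mu> powr (- \<beta>)) * \<omega> (p (path_source E \<mu>)) else 0))"

text \<open>States on the core satisfying the condition, as functions restricted to the core, so that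
  equality of states is equality of functions.\<close>

definition core_states ::
  "('v, 'e) pre_digraph \<Rightarrow> ('v \<Rightarrow> 'a::cstar_algebra) \<Rightarrow> ('e \<Rightarrow> 'a) \<Rightarrow> ('e \<Rightarrow> real) \<Rightarrow> real \<Rightarrow>
   (complex \<Rightarrow> 'a \<Rightarrow> 'a) \<Rightarrow> ('a \<Rightarrow> complex) set" where
  "core_states E p s c \<beta> \<gamma> =
     {\<omega> \<in> extensional (core \<gamma>). state_on (core \<gamma>) \<omega> \<and> core_condition E p s c \<beta> \<omega>}"

definition convex_comb ::
  "real \<Rightarrow> ('a \<Rightarrow> complex) \<Rightarrow> ('a \<Rightarrow> complex) \<Rightarrow> 'a \<Rightarrow> complex" where
  "convex_comb t \<phi> \<psi> x = complex_of_real t * \<phi> x + complex_of_real (1 - t) * \<psi> x"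

end

theory Submission
  imports Defs "HOL-Complex_Analysis.Conformal_Mappings"
begin

text \<open>If \<open>\<sigma>\<^sub>t(x) = e\<^sup>i\<^sup>t\<^sup>l x\<close>, then a KMS state satisfies \<open>\<phi>(xy) = e\<^sup>-\<^sup>\<beta>\<^sup>l \<phi>(yx)\<close> for every \<open>y\<close>,
  whichever dense subalgebra of analytic elements the KMS condition was stated on: compare the means
  of \<open>e\<^sup>-\<^sup>i\<^sup>z\<^sup>l \<phi>(b \<sigma>\<^sub>z(a))\<close> along the two boundary lines of the strip \<open>0 \<le> Im z \<le> \<beta>\<close>. Applied to
  \<open>x = s\<^sub>\<mu>\<close> and \<open>y = s\<^sub>\<nu>\<^sup>*\<close> this reduces \<open>\<phi>(s\<^sub>\<mu> s\<^sub>\<nu>\<^sup>*)\<close> to \<open>\<phi>(s\<^sub>\<nu>\<^sup>* s\<^sub>\<mu>)\<close>, which is \<open>\<phi>(p\<^bsub>s(\<mu>)\<^esub>)\<close>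
  if \<open>\<mu> = \<nu>\<close>, zero if neither path extends the other, and otherwise the value at a path \<open>\<kappa>\<close> of
  positive length or its adjoint; the latter value is multiplied by \<open>c(\<kappa>)\<^sup>\<plusminus>\<^sup>\<beta> \<noteq> 1\<close> by the exchange
  relation and hence vanishes. So KMS states are exactly the states given on the spanning monomials by
  \<open>[\<mu> = \<nu>] c(\<mu>)\<^sup>-\<^sup>\<beta> \<phi>(p\<^bsub>s(\<mu>)\<^esub>)\<close>: conversely, that formula gives the exchange relation for
  the generators, and the relation is inherited by products and adjoints. The sums of vertex projections are
  an approximate unit on which states tend to \<open>1\<close>, so convex combinations of states have norm \<open>1\<close>.\<close>

section \<open>Algebra in C*-algebras\<close>

lemma scaleC_zero_left [simp]: "0 *\<^sub>C (x::'a::cstar_algebra) = 0"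
  using scaleR_scaleC[of 0 x] by simp

lemma scaleC_zero_right [simp]: "a *\<^sub>C (0::'a::cstar_algebra) = 0"
  using scaleC_add_right[of a 0 "0::'a"] by simp

lemma scaleC_one [simp]: "1 *\<^sub>C (x::'a::cstar_algebra) = x"
  using scaleR_scaleC[of 1 x] by simp

lemma adj_zero [simp]: "adj (0::'a::cstar_algebra) = 0"
  using adj_add[of 0 "0::'a"] by simp

lemma adj_scaleR: "adj (r *\<^sub>R (x::'a::cstar_algebra)) = r *\<^sub>R adj x"
  by (simp add: scaleR_scaleC adj_scaleC)

lemma adj_minus: "adj (- (x::'a::cstar_algebra)) = - adj x"
  using adj_scaleR[of "-1" x] by simp

lemma adj_sum: "adj (sum f A) = (\<Sum>i\<in>A. adj (f i :: 'a::cstar_algebra))"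
  by (induction A rule: infinite_finite_induct) (simp_all add: adj_add)

lemma scaleC_diff_right: "a *\<^sub>C (x - y) = a *\<^sub>C x - a *\<^sub>C (y::'a::cstar_algebra)"
  using scaleC_add_right[of a "x - y" y] by (simp add: algebra_simps)

lemma scaleC_minus_left: "(- a) *\<^sub>C x = - (a *\<^sub>C (x::'a::cstar_algebra))"
  using scaleC_scaleC[of "-1" a x] by (simp add: scaleC_minus_one)

lemma scaleR_scaleC_commute: "r *\<^sub>R (a *\<^sub>C (x::'a::cstar_algebra)) = a *\<^sub>C (r *\<^sub>R x)"
  by (simp add: scaleR_scaleC scaleC_scaleC mult.commute)

text \<open>The C*-identity and submultiplicativity give
  \<open>(norm y)\<^sup>2 \<le> norm (adj y) * norm y\<close>. Cancelling \<open>norm y\<close>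
  yields one inequality, and replacing \<open>x\<close> by \<open>adj x\<close> the other.\<close>

lemma norm_adj: "norm (adj x) = norm (x::'a::cstar_algebra)"
proof -
  have le: "norm y \<le> norm (adj y)" for y :: 'a
  proof (cases "y = 0")
    case False
    have "norm y * norm y \<le> norm (adj y) * norm y"
      using cstar_identity[of y] norm_mult_ineq[of "adj y" y] by (simp add: power2_eq_square)
    then show ?thesis using False by simp
  qed simp
  show ?thesis using le[of x] le[of "adj x"] by (simp add: adj_adj)
qed

lemma bounded_linear_adj: "bounded_linear (adj :: 'a::cstar_algebra \<Rightarrow> 'a)"
  by (rule bounded_linear_intro[where K = 1]) (simp_all add: adj_add adj_scaleR norm_adj)

lemma bounded_linear_scaleC: "bounded_linear (\<lambda>x::'a::cstar_algebra. a *\<^sub>C x)"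
  by (rule bounded_linear_intro[where K = "cmod a"])
    (simp_all add: scaleC_add_right scaleR_scaleC_commute norm_scaleC)

lemma bounded_linear_scaleC_left: "bounded_linear (\<lambda>a. a *\<^sub>C (x::'a::cstar_algebra))"
  by (rule bounded_linear_intro[where K = "norm x"])
    (simp_all add: scaleC_add_left scaleR_scaleC scaleC_scaleC norm_scaleC scaleR_conv_of_real)

lemma star_hom_type_cstar:
  fixes \<pi> :: "'a::cstar_algebra \<Rightarrow> 'b::cstar_algebra"
  shows "star_hom type_cstar type_cstar \<pi> \<longleftrightarrow>
    (\<forall>x y. \<pi> (x + y) = \<pi> x + \<pi> y) \<and> (\<forall>a x. \<pi> (a *\<^sub>C x) = a *\<^sub>C \<pi> x) \<and>
    (\<forall>x y. \<pi> (x * y) = \<pi> x * \<pi> y) \<and> (\<forall>x. \<pi> (adj x) = adj (\<pi> x))"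
  by (auto simp: star_hom_def type_cstar_def)

text \<open>The element \<open>1 + u\<close> of the unitisation is a square root of \<open>1 - h\<^sup>2\<close>.\<close>

lemma sqrt_one_minus_square:
  fixes h :: "'a::cstar_algebra"
  assumes "adj h = h" "norm h < 1"
  obtains u where "adj u = u" "u * h = h * u" "h * h + u + u + u * u = 0"
proof -
  \<comment> \<open>The smaller root of \<open>r\<^sup>2 - 2 * r + (norm h)\<^sup>2 = 0\<close>. It
    makes the ball of radius \<open>r\<close> invariant under the map \<open>T\<close> below, and
    \<open>r < 1\<close> also serves as the contraction constant.\<close>
  define r where "r = 1 - sqrt (1 - (norm h)\<^sup>2)"
  have h1: "(norm h)\<^sup>2 < 1" using assms(2) by (simp add: power_less_one_iff abs_square_less_1)
  have r0: "0 \<le> r" and r1: "r < 1" using h1 by (auto simp: r_def)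
  have rr: "(norm h)\<^sup>2 + r\<^sup>2 = 2 * r" using h1
    by (simp add: r_def power2_diff)
  \<comment> \<open>Self-adjointness and commutation with \<open>h\<close> are closed conditions;
    putting them into the domain hands them to the fixed point.\<close>
  define S where "S = cball 0 r \<inter> {u. adj u = u} \<inter> {u. u * h = h * u}"
  define T where "T = (\<lambda>u. - ((1/2) *\<^sub>R (h * h + u * u)))"
  have "closed S" unfolding S_def
    by (intro closed_Int closed_Collect_eq continuous_intros closed_cball
        linear_continuous_on bounded_linear_adj)
  moreover have "0 \<in> S" using r0 by (simp add: S_def)
  then have "S \<noteq> {}" by blast
  moreover have "T ` S \<subseteq> S"
  proof
    fix w assume "w \<in> T ` S"
    then obtain u where u: "norm u \<le> r" "adj u = u" "u * h = h * u" and w: "w = T u"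
      by (auto simp: S_def)
    have "norm (h * h + u * u) \<le> (norm h)\<^sup>2 + r\<^sup>2"
      by (rule norm_triangle_le)
        (use norm_mult_ineq[of h h] norm_mult_ineq[of u u] mult_mono[OF u(1) u(1) r0 norm_ge_zero]
          in \<open>simp add: power2_eq_square\<close>)
    then have "norm w \<le> r" using rr by (simp add: w T_def)
    moreover have "adj w = w"
      by (simp add: w T_def adj_minus adj_scaleR adj_add adj_mult u assms)
    moreover have "u * u * h = h * (u * u)" using u(3) by (metis mult.assoc)
    then have "w * h = h * w" by (simp add: w T_def algebra_simps)
    ultimately show "w \<in> S" by (simp add: S_def)
  qed
  moreover have "dist (T u) (T v) \<le> r * dist u v" if "u \<in> S" "v \<in> S" for u v
  proof -
    have n: "norm u \<le> r" "norm v \<le> r" using that by (auto simp: S_def)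
    have "T u - T v = (1/2) *\<^sub>R ((v - u) * v + u * (v - u))"
      by (simp add: T_def algebra_simps)
    also have "norm \<dots> \<le> (1/2) * (norm (v - u) * r + r * norm (v - u))"
      unfolding norm_scaleR
      by (intro mult_mono norm_triangle_le add_mono order_trans[OF norm_mult_ineq] n) (simp_all add: r0)
    finally show ?thesis by (simp add: dist_norm norm_minus_commute algebra_simps)
  qed
  ultimately obtain u where u: "u \<in> S" "T u = u"
    using Banach_fix[of S r T] r0 r1 by (auto simp: complete_eq_closed)
  have "2 *\<^sub>R u = 2 *\<^sub>R T u" by (simp add: u(2))
  also have "\<dots> = - (h * h + u * u)" unfolding T_def scaleR_minus_right scaleR_scaleR by simp
  finally have "2 *\<^sub>R u + (h * h + u * u) = 0" by simp
  then have "h * h + u + u + u * u = 0" by (simp add: scaleR_2 add_ac)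
  then show ?thesis using u(1) that[of u] by (simp add: S_def)
qed

text \<open>With \<open>(1 + u)\<^sup>2 = 1 - h\<^sup>2\<close>, the element \<open>v = \<pi>(h) + i (1 + \<pi>(u))\<close> of the unitisation is
  unitary, and \<open>\<pi>(h)\<close> is its real part.\<close>

lemma star_hom_norm_le:
  fixes \<pi> :: "'a::cstar_algebra \<Rightarrow> 'b::cstar_algebra"
  assumes "star_hom type_cstar type_cstar \<pi>"
  shows "norm (\<pi> x) \<le> norm x"
proof -
  have hom: "\<pi> (x + y) = \<pi> x + \<pi> y" "\<pi> (a *\<^sub>C x) = a *\<^sub>C \<pi> x" "\<pi> (x * y) = \<pi> x * \<pi> y"
    "\<pi> (adj x) = adj (\<pi> x)" for x y a
    using assms by (auto simp: star_hom_type_cstar)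
  have zero: "\<pi> 0 = 0" using hom(2)[of 0 0] by simp
  have homR: "\<pi> (r *\<^sub>R x) = r *\<^sub>R \<pi> x" for r x by (simp add: scaleR_scaleC hom)
  have unit: "norm (\<pi> h) \<le> 1" if h: "adj h = h" "norm h < 1" for h
  proof -
    obtain u where u: "adj u = u" "u * h = h * u" "h * h + u + u + u * u = 0"
      using sqrt_one_minus_square[OF h] .
    define b where "b = \<pi> h"
    define w where "w = \<pi> u"
    have b: "adj b = b" "adj w = w" "w * b = b * w" "b * b + w + w + w * w = 0"
      using h(1) u by (simp_all add: b_def w_def zero flip: hom)
    \<comment> \<open>The unitary is not an element of the algebra, so it acts by left
      multiplication on \<open>y\<close>; the C*-identity turns \<open>adj v * v = adj y * y\<close>
      into preservation of the norm.\<close>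
    have iso: "norm (b * y + a *\<^sub>C (y + w * y)) = norm y" if a: "a = \<i> \<or> a = -\<i>" for a y
    proof -
      have ca: "cnj a = - a" "a * a = -1" using a by auto
      define v where "v = b * y + a *\<^sub>C (y + w * y)"
      have "adj v * v = adj y * ((b * b + w + w + w * w) * y) + adj y * y
         + a *\<^sub>C (adj y * ((b * w - w * b) * y))"
        by (simp add: v_def adj_add adj_mult adj_scaleC b(1,2) ca algebra_simps mult_scaleC_left
            mult_scaleC_right scaleC_add_right scaleC_scaleC scaleC_diff_right scaleC_minus_one
            scaleC_minus_left)
      then have "adj v * v = adj y * y" by (simp add: b(3,4))
      then have "(norm v)\<^sup>2 = (norm y)\<^sup>2" by (metis cstar_identity)
      then show ?thesis by (simp add: v_def)
    qed
    \<comment> \<open>\<open>2 * b\<close> is the sum of the unitary and its adjoint up to the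
      choice of sign. Both act isometrically on the vector \<open>b\<close> itself, which bounds
      \<open>b * b\<close> by \<open>norm b\<close>.\<close>
    have "2 *\<^sub>R (b * b) = (b * b + \<i> *\<^sub>C (b + w * b)) + (b * b + (-\<i>) *\<^sub>C (b + w * b))"
      using scaleC_add_left[of \<i> "-\<i>" "b + w * b"] by (simp add: scaleR_2 algebra_simps)
    then have "norm (2 *\<^sub>R (b * b)) \<le> norm b + norm b"
      using norm_triangle_ineq[of "b * b + \<i> *\<^sub>C (b + w * b)" "b * b + (-\<i>) *\<^sub>C (b + w * b)"]
        iso[of \<i> b] iso[of "-\<i>" b] by simp
    then have "(norm b)\<^sup>2 \<le> norm b" using cstar_identity[of b] b(1) by simp
    then show ?thesis
      by (cases "norm b = 0") (auto simp: b_def power2_eq_square)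
  qed
  have sa: "norm (\<pi> h) \<le> norm h" if h: "adj h = h" for h
  proof (rule field_le_epsilon)
    fix e :: real assume e: "e > 0"
    \<comment> \<open>Slightly more than \<open>norm h\<close>, since \<open>unit\<close> asks for
      an element of the open unit ball.\<close>
    define d where "d = norm h + e"
    have d: "d > 0" "norm h < d" using e by (auto simp: d_def add_nonneg_pos)
    have "norm (\<pi> ((1/d) *\<^sub>R h)) \<le> 1"
      by (rule unit) (use d in \<open>simp_all add: adj_scaleR h\<close>)
    then show "norm (\<pi> h) \<le> norm h + e" using d
      by (simp add: homR field_simps) (simp add: d_def add.commute)
  qed
  \<comment> \<open>The C*-identity reduces the general case to the self-adjoint element
    \<open>adj x * x\<close>.\<close>
  have "(norm (\<pi> x))\<^sup>2 \<le> (norm x)\<^sup>2"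
    using sa[of "adj x * x"] by (simp add: adj_mult adj_adj hom cstar_identity)
  then show ?thesis by (simp add: power2_le_iff_abs_le)
qed

lemma star_subalgebra_closure:
  assumes "star_subalgebra A"
  shows "star_subalgebra (closure A)"
proof -
  have A: "0 \<in> A" "\<And>x y. x \<in> A \<Longrightarrow> y \<in> A \<Longrightarrow> x + y \<in> A" "\<And>x y. x \<in> A \<Longrightarrow> y \<in> A \<Longrightarrow> x * y \<in> A"
    "\<And>x. x \<in> A \<Longrightarrow> adj x \<in> A" "\<And>x a. x \<in> A \<Longrightarrow> a *\<^sub>C x \<in> A"
    using assms by (auto simp: star_subalgebra_def)
  have "x + y \<in> closure A \<and> x * y \<in> closure A" if xy: "x \<in> closure A" "y \<in> closure A" for x y
  proof -
    obtain f g where fg: "\<forall>n. f n \<in> A" "f \<longlonglongrightarrow> x" "\<forall>n. g n \<in> A" "g \<longlonglongrightarrow> y"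
      using xy unfolding closure_sequential by blast
    have "(\<lambda>n. f n + g n) \<longlonglongrightarrow> x + y" "(\<lambda>n. f n * g n) \<longlonglongrightarrow> x * y"
      by (intro tendsto_intros fg)+
    moreover have "\<forall>n. f n + g n \<in> A" "\<forall>n. f n * g n \<in> A" using A(2,3) fg(1,3) by auto
    ultimately show ?thesis unfolding closure_sequential by (intro conjI exI)
  qed
  moreover have "adj x \<in> closure A \<and> a *\<^sub>C x \<in> closure A" if x: "x \<in> closure A" for x a
  proof -
    obtain f where f: "\<forall>n. f n \<in> A" "f \<longlonglongrightarrow> x"
      using x unfolding closure_sequential by blast
    have "(\<lambda>n. adj (f n)) \<longlonglongrightarrow> adj x" "(\<lambda>n. a *\<^sub>C f n) \<longlonglongrightarrow> a *\<^sub>C x"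
      using bounded_linear.tendsto[OF bounded_linear_adj f(2)]
        bounded_linear.tendsto[OF bounded_linear_scaleC f(2)] by auto
    moreover have "\<forall>n. adj (f n) \<in> A" "\<forall>n. a *\<^sub>C f n \<in> A" using A(4,5) f(1) by auto
    ultimately show ?thesis unfolding closure_sequential by (intro conjI exI)
  qed
  ultimately show ?thesis using A(1) closure_subset[of A] by (auto simp: star_subalgebra_def)
qed

section \<open>Entire functions with values in a C*-algebra\<close>

text \<open>The difference of the mean values of \<open>g\<close> along the two boundary lines of a strip vanishes,
  since the vertical sides of a long rectangle contribute a bounded amount.\<close>

lemma strip_boundary_values:
  fixes g :: "complex \<Rightarrow> complex"
  assumes hol: "g holomorphic_on UNIV" and "\<beta> > 0"
    and M: "\<And>t s. 0 \<le> s \<Longrightarrow> s \<le> \<beta> \<Longrightarrow> cmod (g (Complex t s)) \<le> M"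
    and a: "\<And>t. cmod (g (Complex t 0) - a) \<le> d"
    and b: "\<And>t. cmod (g (Complex t \<beta>) - b) \<le> e"
  shows "cmod (a - b) \<le> d + e"
proof -
  \<comment> \<open>Differences of a primitive replace integrals along the sides, so the four sides
    of a rectangle cancel by mere algebra.\<close>
  obtain P where P: "\<And>z. (P has_field_derivative g z) (at z)"
    using holomorphic_convex_primitive'[OF convex_UNIV open_UNIV hol] by auto
  \<comment> \<open>Mean value inequality for \<open>P z - c * z\<close>, whose derivative is at
    most \<open>r\<close> in modulus on the horizontal line.\<close>
  have hor: "cmod (P (Complex T s) - P (Complex 0 s) - of_real T * c) \<le> r * T"
    if "T \<ge> 0" "\<And>t. cmod (g (Complex t s) - c) \<le> r" for T s c r
  proof -
    have "norm ((P (Complex T s) - c * Complex T s) - (P (Complex 0 s) - c * Complex 0 s))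
        \<le> r * norm (Complex T s - Complex 0 s)"
    proof (rule field_differentiable_bound[of "{z. Im z = s}" _ "\<lambda>z. g z - c"])
      show "convex {z. Im z = s}"
        using convex_hyperplane[of \<i> s] by (simp add: inner_complex_def)
      show "norm (g z - c) \<le> r" if "z \<in> {z. Im z = s}" for z
        using that \<open>\<And>t. cmod (g (Complex t s) - c) \<le> r\<close>[of "Re z"] by (metis complex.collapse mem_Collect_eq)
      show "((\<lambda>z. P z - c * z) has_field_derivative g z - c) (at z within {z. Im z = s})" for z
        by (auto intro!: derivative_eq_intros has_field_derivative_at_within[OF P])
    qed auto
    also have "Complex T s - Complex 0 s = of_real T" by (simp add: complex_eq_iff)
    also have "(P (Complex T s) - c * Complex T s) - (P (Complex 0 s) - c * Complex 0 s)
      = P (Complex T s) - P (Complex 0 s) - c * (Complex T s - Complex 0 s)"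
      by (simp add: algebra_simps)
    also have "Complex T s - Complex 0 s = of_real T" by (simp add: complex_eq_iff)
    finally show ?thesis using that by (simp add: mult.commute)
  qed
  have ver: "cmod (P (Complex t \<beta>) - P (Complex t 0)) \<le> M * \<beta>" for t
  proof -
    have "norm (P (Complex t \<beta>) - P (Complex t 0)) \<le> M * norm (Complex t \<beta> - Complex t 0)"
    proof (rule field_differentiable_bound[of "{z. 0 \<le> Im z} \<inter> {z. Im z \<le> \<beta>}" _ g])
      show "convex ({z. 0 \<le> Im z} \<inter> {z. Im z \<le> \<beta>})"
        using convex_halfspace_ge[of 0 \<i>] convex_halfspace_le[of \<i> \<beta>]
        by (intro convex_Int) (simp_all add: inner_complex_def)
      show "norm (g z) \<le> M" if "z \<in> {z. 0 \<le> Im z} \<inter> {z. Im z \<le> \<beta>}" for z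
        using that M[of "Im z" "Re z"] by simp
    qed (use \<open>\<beta> > 0\<close> in \<open>auto intro: has_field_derivative_at_within[OF P]\<close>)
    also have "Complex t \<beta> - Complex t 0 = \<i> * of_real \<beta>" by (simp add: complex_eq_iff)
    finally show ?thesis using \<open>\<beta> > 0\<close> by (simp add: norm_mult)
  qed
  have est: "cmod (a - b) * T \<le> (d + e) * T + 2 * M * \<beta>" if "T \<ge> 0" for T
  proof -
    define x1 where "x1 = P (Complex T 0) - P (Complex 0 0) - of_real T * a"
    define x2 where "x2 = P (Complex T \<beta>) - P (Complex 0 \<beta>) - of_real T * b"
    define x3 where "x3 = P (Complex T \<beta>) - P (Complex T 0)"
    define x4 where "x4 = P (Complex 0 \<beta>) - P (Complex 0 0)"
    have "cmod x1 \<le> d * T" "cmod x2 \<le> e * T" "cmod x3 \<le> M * \<beta>" "cmod x4 \<le> M * \<beta>"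
      unfolding x1_def x2_def x3_def x4_def using hor[OF that] a b ver by blast+
    moreover have "of_real T * (a - b) = x2 - x1 - x3 + x4"
      by (simp add: x1_def x2_def x3_def x4_def algebra_simps)
    then have "cmod (of_real T * (a - b)) \<le> cmod x2 + cmod x1 + cmod x3 + cmod x4"
      using norm_triangle_ineq[of "x2 - x1 - x3" x4] norm_triangle_ineq4[of "x2 - x1" x3]
        norm_triangle_ineq4[of x2 x1] by simp
    ultimately show ?thesis using that by (simp add: norm_mult) (simp add: algebra_simps)
  qed
  show ?thesis
  proof (rule ccontr)
    assume "\<not> ?thesis"
    then have pos: "cmod (a - b) - (d + e) > 0" by simp
    have "0 \<le> M" using M[of 0 0] \<open>\<beta> > 0\<close> by (meson less_imp_le norm_ge_zero order_refl order_trans)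
    \<comment> \<open>At this length the left side of \<open>est\<close> exceeds the right side by
      exactly one.\<close>
    define T where "T = (2 * M * \<beta> + 1) / (cmod (a - b) - (d + e))"
    have "T \<ge> 0" using pos \<open>0 \<le> M\<close> \<open>\<beta> > 0\<close> by (simp add: T_def)
    moreover have "(cmod (a - b) - (d + e)) * T = 2 * M * \<beta> + 1" using pos by (simp add: T_def)
    ultimately show False using est[of T] by (simp add: algebra_simps)
  qed
qed

lemma entire_zero: "entire (\<lambda>_. 0)"
  by (auto simp: entire_def intro!: exI tendsto_const)

lemma entire_add:
  assumes "entire F" "entire G"
  shows "entire (\<lambda>z. F z + G z)"
  unfolding entire_def
proof
  fix z
  obtain D D' where "((\<lambda>w. inverse (w - z) *\<^sub>C (F w - F z)) \<longlongrightarrow> D) (at z)"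
    "((\<lambda>w. inverse (w - z) *\<^sub>C (G w - G z)) \<longlongrightarrow> D') (at z)"
    using assms unfolding entire_def by meson
  from tendsto_add[OF this]
  show "\<exists>D. ((\<lambda>w. inverse (w - z) *\<^sub>C (F w + G w - (F z + G z))) \<longlongrightarrow> D) (at z)"
    by (intro exI) (simp add: scaleC_add_right[symmetric] algebra_simps)
qed

lemma entire_linear:
  assumes "entire F" and "bounded_linear L" and "\<And>a x. L (a *\<^sub>C x) = a *\<^sub>C L x"
  shows "entire (\<lambda>z. L (F z))"
  unfolding entire_def
proof
  fix z
  obtain D where "((\<lambda>w. inverse (w - z) *\<^sub>C (F w - F z)) \<longlongrightarrow> D) (at z)"
    using assms(1) by (auto simp: entire_def)
  from bounded_linear.tendsto[OF assms(2) this]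
  show "\<exists>D. ((\<lambda>w. inverse (w - z) *\<^sub>C (L (F w) - L (F z))) \<longlongrightarrow> D) (at z)"
    by (intro exI) (simp add: assms(3) bounded_linear.linear[OF assms(2)] linear_diff)
qed

lemma entire_shift:
  assumes "entire F"
  shows "entire (\<lambda>z. F (z + a))"
  unfolding entire_def
proof
  fix z
  obtain D where "((\<lambda>w. inverse (w - (z + a)) *\<^sub>C (F w - F (z + a))) \<longlongrightarrow> D) (at (z + a))"
    using assms by (auto simp: entire_def)
  then show "\<exists>D. ((\<lambda>w. inverse (w - z) *\<^sub>C (F (w + a) - F (z + a))) \<longlongrightarrow> D) (at z)"
    unfolding at_to_0[of z] at_to_0[of "z + a"] filterlim_filtermap
    by (intro exI) (simp add: add_ac)
qed

lemma entire_scaleC_left: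
  assumes "f holomorphic_on UNIV"
  shows "entire (\<lambda>z. f z *\<^sub>C x)"
  unfolding entire_def
proof
  fix z
  have "(f has_field_derivative deriv f z) (at z)"
    using assms by (simp add: holomorphic_derivI)
  then have "((\<lambda>w. inverse (w - z) * (f w - f z)) \<longlongrightarrow> deriv f z) (at z)"
    by (simp add: has_field_derivative_iff divide_inverse mult.commute)
  from bounded_linear.tendsto[OF bounded_linear_scaleC_left[of x] this]
  show "\<exists>D. ((\<lambda>w. inverse (w - z) *\<^sub>C (f w *\<^sub>C x - f z *\<^sub>C x)) \<longlongrightarrow> D) (at z)"
    by (intro exI) (simp add: scaleC_scaleC[symmetric] linear_diff[OF bounded_linear.linear[OF bounded_linear_scaleC_left]])
qed

text \<open>A bounded functional carries algebra-valued entire functions into scalar complex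
  analysis, where the identity theorem and the strip estimate are available.\<close>

lemma entire_imp_holomorphic:
  fixes \<phi> :: "'a::cstar_algebra \<Rightarrow> complex"
  assumes "entire F" and "bounded_linear \<phi>" and "\<And>a x. \<phi> (a *\<^sub>C x) = a * \<phi> x"
  shows "(\<lambda>z. \<phi> (F z)) holomorphic_on UNIV"
proof -
  have "\<exists>D. ((\<lambda>z. \<phi> (F z)) has_field_derivative D) (at z)" for z
  proof -
    obtain D where "((\<lambda>w. inverse (w - z) *\<^sub>C (F w - F z)) \<longlongrightarrow> D) (at z)"
      using assms(1) by (auto simp: entire_def)
    from bounded_linear.tendsto[OF assms(2) this]
    show ?thesis
      by (intro exI) (simp add: has_field_derivative_iff assms(3) divide_inverse mult.commute
          bounded_linear.linear[OF assms(2)] linear_diff)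
  qed
  then show ?thesis by (simp add: holomorphic_on_def field_differentiable_def)
qed

text \<open>The increment of \<open>F\<close> has norm \<open>norm (w - z)\<close> times that of a
  convergent difference quotient.\<close>

lemma entire_imp_isCont:
  assumes "entire F"
  shows "isCont F z"
proof -
  obtain D where D: "((\<lambda>w. inverse (w - z) *\<^sub>C (F w - F z)) \<longlongrightarrow> D) (at z)"
    using assms by (auto simp: entire_def)
  have "((\<lambda>w. norm (w - z) * norm (inverse (w - z) *\<^sub>C (F w - F z))) \<longlongrightarrow> norm (z - z) * norm D) (at z)"
    by (intro tendsto_intros D)
  then have "((\<lambda>w. norm (F w - F z)) \<longlongrightarrow> norm (z - z) * norm D) (at z)"
    by (rule Lim_transform_eventually)
      (auto simp: eventually_at_filter norm_scaleC norm_inverse intro!: always_eventually)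
  then show ?thesis
    by (simp add: isCont_def LIM_zero_iff tendsto_norm_zero_iff)
qed

text \<open>Both sides agree on the real line, which accumulates at 0, so the identity theorem
  applies. Uniqueness under a functional suffices: the KMS condition sees an extension only through
  the state.\<close>

lemma entire_extension_unique:
  fixes \<phi> :: "'a::cstar_algebra \<Rightarrow> complex"
  assumes "entire_extension \<sigma> x F" "entire_extension \<sigma> x G"
    and "bounded_linear \<phi>" and "\<And>a x. \<phi> (a *\<^sub>C x) = a * \<phi> x"
  shows "\<phi> (F z) = \<phi> (G z)"
proof -
  have "\<phi> (F z) - \<phi> (G z) = 0"
  proof (rule analytic_continuation[of "\<lambda>z. \<phi> (F z) - \<phi> (G z)" UNIV \<real> 0])
    show "(\<lambda>z. \<phi> (F z) - \<phi> (G z)) holomorphic_on UNIV"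
      using assms by (intro holomorphic_intros entire_imp_holomorphic) (auto simp: entire_extension_def)
    show "0 islimpt (\<real>::complex set)"
    proof (rule islimpt_sequential[THEN iffD2], intro exI conjI allI)
      show "complex_of_real (inverse (real (Suc n))) \<in> \<real> - {0}" for n
        by (simp del: of_real_inverse of_nat_Suc)
      show "(\<lambda>n. complex_of_real (inverse (real (Suc n)))) \<longlonglongrightarrow> 0"
        using tendsto_of_real[OF LIMSEQ_inverse_real_of_nat] by (metis of_real_0)
    qed
    show "\<phi> (F z) - \<phi> (G z) = 0" if "z \<in> \<real>" for z
      using that assms(1,2) by (auto simp: entire_extension_def elim!: Reals_cases)
  qed auto
  then show ?thesis by simp
qed

section \<open>States\<close>

lemma state_on_bound:
  assumes "state_on UNIV \<phi>"
  shows "cmod (\<phi> x) \<le> norm x"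
proof (cases "x = 0")
  case True
  have "\<phi> (0 *\<^sub>C x) = 0 * \<phi> x" using assms unfolding state_on_def by blast
  then show ?thesis using True by simp
next
  case False
  define y where "y = complex_of_real (1 / norm x) *\<^sub>C x"
  have "cmod (\<phi> y) \<le> (SUP x \<in> UNIV \<inter> cball 0 1. cmod (\<phi> x))"
    using assms False by (intro cSUP_upper) (auto simp: state_on_def y_def norm_scaleC norm_divide)
  then have "cmod (\<phi> y) \<le> 1" using assms by (simp add: state_on_def)
  moreover have "\<phi> y = complex_of_real (1 / norm x) * \<phi> x"
    using assms by (simp add: state_on_def y_def)
  ultimately show ?thesis using False by (simp add: norm_mult norm_divide field_simps)
qed

lemma state_on_linear:
  assumes "state_on UNIV \<phi>"
  shows "\<phi> (x + y) = \<phi> x + \<phi> y" "\<phi> (a *\<^sub>C x) = a * \<phi> x" "bounded_linear \<phi>"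
    "\<phi> 0 = 0" "\<phi> (x - y) = \<phi> x - \<phi> y"
proof -
  show 1: "\<phi> (x + y) = \<phi> x + \<phi> y" "\<phi> (a *\<^sub>C x) = a * \<phi> x" for x y a
    using assms by (auto simp: state_on_def)
  show bl: "bounded_linear \<phi>"
    by (rule bounded_linear_intro[where K = 1])
      (simp_all add: 1 scaleR_scaleC scaleR_conv_of_real state_on_bound[OF assms])
  show "\<phi> 0 = 0" "\<phi> (x - y) = \<phi> x - \<phi> y"
    using bounded_linear.linear[OF bl] by (simp_all add: linear_0 linear_diff)
qed

lemma state_on_left_mult:
  assumes "state_on UNIV \<phi>"
  shows "bounded_linear (\<lambda>x. \<phi> (y * x))" "\<phi> (y * (a *\<^sub>C x)) = a * \<phi> (y * x)"
  using bounded_linear_compose[OF state_on_linear(3)[OF assms] bounded_linear_mult_right[of y]]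
  by (simp_all add: mult_scaleC_right state_on_linear[OF assms])

lemma state_on_le_one:
  assumes "state_on A \<phi>" "x \<in> A" "norm x \<le> 1"
  shows "cmod (\<phi> x) \<le> 1"
proof -
  have "cmod (\<phi> x) \<le> (SUP x \<in> A \<inter> cball 0 1. cmod (\<phi> x))"
    using assms by (intro cSUP_upper) (auto simp: state_on_def)
  then show ?thesis using assms(1) by (simp add: state_on_def)
qed

lemma state_on_approx:
  assumes "state_on A \<phi>" "0 \<in> A" "e > 0"
  obtains x where "x \<in> A" "norm x \<le> 1" "cmod (\<phi> x) > 1 - e"
proof -
  have "1 - e < (SUP x \<in> A \<inter> cball 0 1. cmod (\<phi> x))"
    using assms by (simp add: state_on_def)
  moreover have "A \<inter> cball 0 1 \<noteq> {}" using assms(2) by auto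
  moreover have "bdd_above ((\<lambda>x. cmod (\<phi> x)) ` (A \<inter> cball 0 1))"
    using assms(1) by (simp add: state_on_def)
  ultimately have "\<exists>x\<in>A \<inter> cball 0 1. 1 - e < cmod (\<phi> x)"
    using less_cSUP_iff[of "A \<inter> cball 0 1" "\<lambda>x. cmod (\<phi> x)" "1 - e"] by blast
  then show ?thesis using that by auto
qed

text \<open>Norm one is split into an upper bound and near-attainment, because there may be no unit
  at which a state takes the value one.\<close>

lemma state_onI:
  assumes "\<And>x y. x \<in> A \<Longrightarrow> y \<in> A \<Longrightarrow> \<phi> (x + y) = \<phi> x + \<phi> y"
    and "\<And>a x. x \<in> A \<Longrightarrow> \<phi> (a *\<^sub>C x) = a * \<phi> x"
    and "\<And>x. x \<in> A \<Longrightarrow> \<phi> (adj x * x) \<in> \<real>\<^sub>\<ge>\<^sub>0"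
    and le: "\<And>x. x \<in> A \<Longrightarrow> norm x \<le> 1 \<Longrightarrow> cmod (\<phi> x) \<le> 1"
    and ge: "\<And>e. e > 0 \<Longrightarrow> \<exists>x\<in>A. norm x \<le> 1 \<and> cmod (\<phi> x) \<ge> 1 - e"
  shows "state_on A \<phi>"
proof -
  have bdd: "bdd_above ((\<lambda>x. cmod (\<phi> x)) ` (A \<inter> cball 0 1))"
    using le by (auto simp: bdd_above_def intro!: exI[of _ 1])
  have "(SUP x \<in> A \<inter> cball 0 1. cmod (\<phi> x)) = 1"
  proof (rule antisym)
    show "(SUP x \<in> A \<inter> cball 0 1. cmod (\<phi> x)) \<le> 1"
      using ge[of 1] le by (intro cSUP_least) auto
    show "1 \<le> (SUP x \<in> A \<inter> cball 0 1. cmod (\<phi> x))"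
    proof (rule field_le_epsilon)
      fix e :: real assume "e > 0"
      then obtain x where x: "x \<in> A" "norm x \<le> 1" "cmod (\<phi> x) \<ge> 1 - e" using ge by blast
      then have "cmod (\<phi> x) \<le> (SUP x \<in> A \<inter> cball 0 1. cmod (\<phi> x))"
        by (intro cSUP_upper bdd) simp
      then show "1 \<le> (SUP x \<in> A \<inter> cball 0 1. cmod (\<phi> x)) + e" using x(3) by linarith
    qed
  qed
  then show ?thesis using assms(1-3) bdd by (simp add: state_on_def)
qed

text \<open>A Cauchy--Schwarz estimate without division: expand \<open>\<phi>((x - m q)\<^sup>*(x - m q)) \<ge> 0\<close>
  for \<open>m = \<phi>(qx)\<close>.\<close>

lemma state_projection_estimate:
  assumes "state_on UNIV \<phi>" and q: "adj q = q" "q * q = q" and "norm x \<le> 1"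
  shows "2 * (cmod (\<phi> (q * x)))\<^sup>2 \<le> 1 + (cmod (\<phi> (q * x)))\<^sup>2 * Re (\<phi> q)"
proof -
  note lin = state_on_linear[OF assms(1)]
  have pos: "\<phi> (adj y * y) \<in> \<real>\<^sub>\<ge>\<^sub>0" for y using assms(1) by (simp add: state_on_def)
  define a where "a = \<phi> (adj x * q)"
  define m where "m = \<phi> (q * x)"
  have ex: "\<phi> (adj (x + z *\<^sub>C q) * (x + z *\<^sub>C q)) = \<phi> (adj x * x) + z * a + cnj z * m + (z * cnj z) * \<phi> q" for z
    by (simp add: adj_add adj_scaleC q algebra_simps mult_scaleC_left mult_scaleC_right lin a_def m_def)
  have "\<phi> (adj q * q) \<in> \<real>\<^sub>\<ge>\<^sub>0" "\<phi> (adj x * x) \<in> \<real>\<^sub>\<ge>\<^sub>0" by (rule pos)+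
  then have Im0: "Im (\<phi> q) = 0" "Im (\<phi> (adj x * x)) = 0"
    by (auto simp: q complex_nonneg_Reals_iff)
  \<comment> \<open>The expansion is real at \<open>z = 1\<close> and at \<open>z = \<i>\<close>;
    together these two values force \<open>a = cnj m\<close>.\<close>
  have "Im a + Im m = 0" using pos[of "x + 1 *\<^sub>C q"] Im0 unfolding ex
    by (simp add: complex_nonneg_Reals_iff)
  moreover have "Re a - Re m = 0" using pos[of "x + \<i> *\<^sub>C q"] Im0 unfolding ex
    by (simp add: complex_nonneg_Reals_iff)
  ultimately have a: "a = cnj m" by (simp add: complex_eq_iff)
  have mm: "m * cnj m = of_real ((cmod m)\<^sup>2)" "cnj m * m = of_real ((cmod m)\<^sup>2)"
    by (simp_all only: complex_norm_square mult.commute)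
  have "Re (\<phi> (adj x * x)) \<le> 1"
  proof -
    have "cmod (\<phi> (adj x * x)) \<le> (norm x)\<^sup>2"
      using state_on_bound[OF assms(1), of "adj x * x"] by (simp add: cstar_identity)
    also have "\<dots> \<le> 1" using assms(4) by (simp add: power_le_one)
    finally show ?thesis using complex_Re_le_cmod order_trans by blast
  qed
  moreover have "\<phi> (adj (x + (- m) *\<^sub>C q) * (x + (- m) *\<^sub>C q)) =
      \<phi> (adj x * x) - 2 * of_real ((cmod m)\<^sup>2) + of_real ((cmod m)\<^sup>2) * \<phi> q"
    unfolding ex a by (simp only: mm complex_cnj_minus mult_minus_left mult_minus_right minus_minus) simp
  then have "0 \<le> Re (\<phi> (adj x * x)) - 2 * (cmod m)\<^sup>2 + (cmod m)\<^sup>2 * Re (\<phi> q)"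
    using pos[of "x + (- m) *\<^sub>C q"] by (simp add: complex_nonneg_Reals_iff)
  ultimately show ?thesis unfolding m_def[symmetric] by linarith
qed


section \<open>The KMS condition on eigenvectors\<close>

text \<open>Inside a state, the extension picked by \<open>SOME\<close> may be replaced by any
  explicitly known one.\<close>

lemma state_on_complex_flow:
  assumes "state_on UNIV \<phi>" "entire_extension \<sigma> x F"
  shows "\<phi> (y * complex_flow \<sigma> z x) = \<phi> (y * F z)"
proof -
  have "entire_extension \<sigma> x (SOME F. entire_extension \<sigma> x F)"
    using someI[of "entire_extension \<sigma> x", OF assms(2)] by simp
  then show ?thesis
    unfolding complex_flow_def
    by (rule entire_extension_unique[OF _ assms(2)]) (rule state_on_left_mult[OF assms(1)])+
qed

locale flow =
  fixes \<sigma> :: "real \<Rightarrow> 'a::cstar_algebra \<Rightarrow> 'a"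
  assumes automorphism: "star_automorphism (\<sigma> t)"
    and group_law: "\<sigma> (t + u) = \<sigma> t \<circ> \<sigma> u"
begin

lemma hom:
  "\<sigma> t (x + y) = \<sigma> t x + \<sigma> t y" "\<sigma> t (a *\<^sub>C x) = a *\<^sub>C \<sigma> t x" "\<sigma> t (x * y) = \<sigma> t x * \<sigma> t y"
  "\<sigma> t (adj x) = adj (\<sigma> t x)" "norm (\<sigma> t x) \<le> norm x"
  using automorphism[of t] star_hom_norm_le[of "\<sigma> t" x]
  by (auto simp: star_automorphism_def star_hom_type_cstar)

lemma bounded_linear_flow: "bounded_linear (\<sigma> t)"
  by (rule bounded_linear_intro[where K = 1]) (simp_all add: hom scaleR_scaleC)

lemma flow_diff: "\<sigma> t (x - y) = \<sigma> t x - \<sigma> t y"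
  using bounded_linear.linear[OF bounded_linear_flow] by (rule linear_diff)

text \<open>Two extensions of the same element. Comparing them shows that a horizontal translation
  of the argument acts like the contraction \<open>\<sigma> t\<close>.\<close>

lemma entire_extension_shift:
  assumes "entire_extension \<sigma> x F"
  shows "entire_extension \<sigma> (\<sigma> t x) (\<lambda>z. F (z + of_real t))"
    and "entire_extension \<sigma> (\<sigma> t x) (\<lambda>z. \<sigma> t (F z))"
proof -
  have F: "entire F" "\<And>u. F (of_real u) = \<sigma> u x" using assms by (auto simp: entire_extension_def)
  have "F (of_real u + of_real t) = \<sigma> u (\<sigma> t x)" for u
    using F(2)[of "u + t"] group_law[of u t] by simp
  then show "entire_extension \<sigma> (\<sigma> t x) (\<lambda>z. F (z + of_real t))"
    using F(1) by (simp add: entire_extension_def entire_shift)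
  have "\<sigma> t (\<sigma> u x) = \<sigma> u (\<sigma> t x)" for u
    by (metis add.commute comp_apply group_law)
  then show "entire_extension \<sigma> (\<sigma> t x) (\<lambda>z. \<sigma> t (F z))"
    using F by (simp add: entire_extension_def entire_linear bounded_linear_flow hom)
qed

text \<open>The eigenvalue is recorded by its logarithm: weight \<open>w\<close> corresponds to
  \<open>l = ln w\<close>, so that exponents add under products and change sign under
  \<open>adj\<close>.\<close>

definition eigenvector :: "real \<Rightarrow> 'a \<Rightarrow> bool" where
  "eigenvector l x \<longleftrightarrow> (\<forall>t. \<sigma> t x = exp (\<i> * of_real (t * l)) *\<^sub>C x)"

lemma eigenvector_mult:
  "eigenvector l x \<Longrightarrow> eigenvector m y \<Longrightarrow> eigenvector (l + m) (x * y)"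
  by (simp add: eigenvector_def hom mult_scaleC_left mult_scaleC_right scaleC_scaleC
      ring_distribs flip: exp_add) (simp add: add.commute)

lemma eigenvector_adj: "eigenvector l x \<Longrightarrow> eigenvector (- l) (adj x)"
  by (simp add: eigenvector_def hom adj_scaleC exp_cnj)

lemma eigenvector_scaleC: "eigenvector l x \<Longrightarrow> eigenvector l (a *\<^sub>C x)"
  by (simp add: eigenvector_def hom(2) scaleC_scaleC mult.commute)

lemma eigenvector_entire_extension:
  assumes "eigenvector l x"
  shows "entire_extension \<sigma> x (\<lambda>z. exp (\<i> * z * of_real l) *\<^sub>C x)"
  using assms unfolding entire_extension_def
  by (auto simp: eigenvector_def mult.assoc intro!: entire_scaleC_left holomorphic_intros)

text \<open>For \<open>a, b\<close> in the dense subalgebra of the KMS condition near \<open>x, y\<close>, the entire function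
  \<open>e\<^sup>-\<^sup>i\<^sup>z\<^sup>l \<phi>(b \<sigma>\<^sub>z(a))\<close> is near \<open>\<phi>(yx)\<close> on the real line and near \<open>e\<^sup>\<beta>\<^sup>l \<phi>(xy)\<close> on \<open>Im z = \<beta>\<close>.\<close>

lemma KMS_eigenvector:
  assumes KMS: "KMS_state \<sigma> \<beta> \<phi>" and "\<beta> > 0" and x: "eigenvector l x"
  shows "\<phi> (x * y) = exp (- of_real (\<beta> * l)) * \<phi> (y * x)"
proof -
  have state: "state_on UNIV \<phi>" using KMS by (simp add: KMS_state_def)
  note lin = state_on_linear[OF state] and bd = state_on_bound[OF state]
  obtain D where D2: "closure D = UNIV" and inv: "\<forall>t. \<sigma> t ` D \<subseteq> D"
    and ext: "\<forall>x\<in>D. entire_analytic \<sigma> x"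
    and rel: "\<forall>x\<in>D. \<forall>y\<in>D. \<phi> (x * y) = \<phi> (y * complex_flow \<sigma> (\<i> * complex_of_real \<beta>) x)"
    using KMS unfolding KMS_state_def by (elim conjE exE) (rule that)
  define C where "C = exp (\<beta> * l)"
  have C: "C > 0" by (simp add: C_def)
  define N where "N = norm x + norm y + 1"
  have N: "N > 0" by (simp add: N_def add_nonneg_pos)
  have close: "cmod (\<phi> (y * x) - of_real C * \<phi> (x * y)) \<le> d * (N + C * N)" if d: "d > 0" "d \<le> 1" for d
  proof -
    obtain a b where a: "a \<in> D" "norm (a - x) \<le> d" and b: "b \<in> D" "norm (b - y) \<le> d"
      using d(1) closure_approachable[of x D] closure_approachable[of y D]
      unfolding D2 dist_norm by (meson UNIV_I less_imp_le)
    obtain F where F: "entire_extension \<sigma> a F" using ext a(1) by (auto simp: entire_analytic_def)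
    then have entF: "entire F" and Freal: "\<And>t. F (of_real t) = \<sigma> t a" by (auto simp: entire_extension_def)
    define e where "e = (\<lambda>z. exp (- (\<i> * z * of_real l)))"
    \<comment> \<open>The factor \<open>e\<close> cancels the eigenvalue of \<open>x\<close>: with
      \<open>x\<close> in place of \<open>a\<close>, this function would be constant on the real
      line.\<close>
    define g where "g = (\<lambda>z. e z * \<phi> (b * F z))"
    have g: "g holomorphic_on UNIV" unfolding g_def e_def
      by (intro holomorphic_intros entire_imp_holomorphic[OF entF] state_on_left_mult[OF state])
    have shift: "\<phi> (b * F (z + of_real t)) = \<phi> (b * \<sigma> t (F z))" for z t
      using entire_extension_shift[OF F]
      by (rule entire_extension_unique) (rule state_on_left_mult[OF state])+
    \<comment> \<open>The KMS relation is used for \<open>\<sigma> t a\<close>, which again lies in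
      \<open>D\<close>. Its extension is the shift of \<open>F\<close> by \<open>t\<close>, so the
      value at \<open>\<i> * \<beta>\<close> is a value of \<open>F\<close> on the upper boundary
      line.\<close>
    have top: "\<phi> (b * F (of_real t + \<i> * of_real \<beta>)) = \<phi> (\<sigma> t a * b)" for t
    proof -
      have "\<sigma> t a \<in> D" using inv a(1) by blast
      with rel b(1) show ?thesis
        by (simp add: state_on_complex_flow[OF state entire_extension_shift(1)[OF F]] add.commute)
    qed
    have ecmod: "cmod (e (Complex t s)) = exp (s * l)" for t s
      by (simp add: e_def norm_exp_eq_Re)
    have cx: "Complex t s = \<i> * of_real s + of_real t" for t s by (simp add: complex_eq_iff)
    have ex: "e (of_real t) *\<^sub>C \<sigma> t x = x" for t
      using x by (simp add: eigenvector_def e_def scaleC_scaleC mult.assoc flip: exp_add)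
    have diff: "norm (b * \<sigma> t a - y * \<sigma> t x) \<le> d * N" "norm (\<sigma> t a * b - \<sigma> t x * y) \<le> d * N" for t
    proof -
      have bnd: "norm b * d + d * norm x \<le> d * N"
      proof -
        have "norm b \<le> d + norm y" using norm_triangle_ineq[of "b - y" y] b(2) by simp
        then have "d * (norm b + norm x) \<le> d * N" using d by (intro mult_left_mono) (auto simp: N_def)
        then show ?thesis by (simp add: algebra_simps)
      qed
      have i: "norm (\<sigma> t (a - x)) \<le> d" "norm (\<sigma> t x) \<le> norm x"
        using hom(5)[of t "a - x"] hom(5)[of t x] a(2) by auto
      have "b * \<sigma> t a - y * \<sigma> t x = b * \<sigma> t (a - x) + (b - y) * \<sigma> t x"
        "\<sigma> t a * b - \<sigma> t x * y = \<sigma> t (a - x) * b + \<sigma> t x * (b - y)"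
        by (simp_all add: flow_diff algebra_simps)
      moreover have m: "norm (u * v) \<le> r * q" if "norm u \<le> r" "norm v \<le> q" for u v :: 'a and r q
        using that by (meson mult_mono norm_ge_zero norm_mult_ineq order_trans)
      have "norm (b * \<sigma> t (a - x)) \<le> norm b * d" "norm (\<sigma> t (a - x) * b) \<le> d * norm b"
        "norm ((b - y) * \<sigma> t x) \<le> d * norm x" "norm (\<sigma> t x * (b - y)) \<le> norm x * d"
        by (intro m i b(2) order_refl)+
      ultimately show "norm (b * \<sigma> t a - y * \<sigma> t x) \<le> d * N" "norm (\<sigma> t a * b - \<sigma> t x * y) \<le> d * N"
        using bnd norm_triangle_ineq[of "b * \<sigma> t (a - x)" "(b - y) * \<sigma> t x"]
          norm_triangle_ineq[of "\<sigma> t (a - x) * b" "\<sigma> t x * (b - y)"]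
        by (simp_all add: mult.commute)
    qed
    have e0: "cmod (g (Complex t 0) - \<phi> (y * x)) \<le> d * N" for t
    proof -
      have "g (Complex t 0) - \<phi> (y * x) = e (of_real t) * \<phi> (b * \<sigma> t a - y * \<sigma> t x)"
        using ex[of t] lin(2)[of "e (of_real t)" "y * \<sigma> t x"]
        by (simp add: g_def cx Freal lin(5) algebra_simps flip: mult_scaleC_right)
      then show ?thesis using ecmod[of t 0] bd[of "b * \<sigma> t a - y * \<sigma> t x"] diff(1)[of t]
        by (simp add: norm_mult cx)
    qed
    have e1: "cmod (g (Complex t \<beta>) - of_real C * \<phi> (x * y)) \<le> C * (d * N)" for t
    proof -
      have eC: "e (Complex t \<beta>) = of_real C * e (of_real t)"
        by (simp add: e_def cx C_def algebra_simps exp_of_real[symmetric] flip: exp_add)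
      have "g (Complex t \<beta>) - of_real C * \<phi> (x * y)
          = of_real C * (e (of_real t) * \<phi> (\<sigma> t a * b - \<sigma> t x * y))"
        using ex[of t] lin(2)[of "e (of_real t)" "\<sigma> t x * y"] top[of t]
        by (simp add: g_def eC lin(5) algebra_simps flip: mult_scaleC_left) (simp add: cx add.commute)
      then show ?thesis using ecmod[of t 0] bd[of "\<sigma> t a * b - \<sigma> t x * y"] diff(2)[of t] C
        by (simp add: norm_mult cx)
    qed
    \<comment> \<open>Boundedness of \<open>g\<close> on the whole strip: \<open>F\<close> is
      bounded on the compact segment from \<open>0\<close> to \<open>\<i> * \<beta>\<close>, and
      \<open>shift\<close> carries the bound along horizontal lines.\<close>
    have "continuous_on {0..\<beta>} (\<lambda>s. F (\<i> * of_real s))"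
      by (rule continuous_on_compose2[of UNIV F])
        (auto intro!: continuous_intros continuous_at_imp_continuous_on entire_imp_isCont[OF entF])
    then have "continuous_on {0..\<beta>} (\<lambda>s. exp (s * l) * (norm b * norm (F (\<i> * of_real s))))"
      by (intro continuous_intros)
    then have "compact ((\<lambda>s. exp (s * l) * (norm b * norm (F (\<i> * of_real s)))) ` {0..\<beta>})"
      by (rule compact_continuous_image) simp
    then have "bdd_above ((\<lambda>s. exp (s * l) * (norm b * norm (F (\<i> * of_real s)))) ` {0..\<beta>})"
      by (intro bounded_imp_bdd_above compact_imp_bounded)
    then obtain M where M: "\<forall>s\<in>{0..\<beta>}. exp (s * l) * (norm b * norm (F (\<i> * of_real s))) \<le> M"
      unfolding bdd_above_def by auto
    have "cmod (g (Complex t s)) \<le> M" if "0 \<le> s" "s \<le> \<beta>" for t s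
    proof -
      have "cmod (\<phi> (b * \<sigma> t (F (\<i> * of_real s)))) \<le> norm b * norm (F (\<i> * of_real s))"
        by (intro order_trans[OF bd] order_trans[OF norm_mult_ineq] mult_left_mono hom) simp
      then have "cmod (g (Complex t s)) \<le> exp (s * l) * (norm b * norm (F (\<i> * of_real s)))"
        unfolding g_def norm_mult ecmod by (simp add: cx shift)
      then show ?thesis using M that by (meson atLeastAtMost_iff order_trans)
    qed
    from strip_boundary_values[OF g \<open>\<beta> > 0\<close> this e0 e1] show ?thesis by (simp add: algebra_simps)
  qed
  have "cmod (\<phi> (y * x) - of_real C * \<phi> (x * y)) \<le> 0"
  proof (rule field_le_epsilon)
    fix \<epsilon> :: real assume "\<epsilon> > 0"
    have K: "N + C * N > 0" using N C by (simp add: add_pos_pos)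
    define d where "d = min 1 (\<epsilon> / (N + C * N))"
    have d: "d > 0" "d \<le> 1" "d \<le> \<epsilon> / (N + C * N)" using \<open>\<epsilon> > 0\<close> K by (auto simp: d_def)
    then have "d * (N + C * N) \<le> \<epsilon>" using K by (simp add: pos_le_divide_eq)
    then show "cmod (\<phi> (y * x) - of_real C * \<phi> (x * y)) \<le> 0 + \<epsilon>" using close[OF d(1,2)] by simp
  qed
  then have "\<phi> (y * x) = of_real C * \<phi> (x * y)" by simp
  then show ?thesis by (simp add: C_def exp_of_real[symmetric] flip: exp_add mult.assoc)
qed

end

section \<open>Paths\<close>

text \<open>The vertex is dropped because the new edge already records it as its tail. The value is
  meaningful when the tail of \<open>e\<close> is the range of the path.\<close>

fun cons_path :: "'e \<Rightarrow> ('v, 'e) gpath \<Rightarrow> ('v, 'e) gpath" where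
  "cons_path e (Vertex v) = Edges [e]"
| "cons_path e (Edges es) = Edges (e # es)"

fun path_range :: "('v, 'e) pre_digraph \<Rightarrow> ('v, 'e) gpath \<Rightarrow> 'v" where
  "path_range E (Vertex v) = v"
| "path_range E (Edges es) = head E (hd es)"

lemma Vertex_in_paths [simp]: "Vertex v \<in> paths E \<longleftrightarrow> v \<in> verts E"
  by (auto simp: paths_def)

lemma Edges_in_paths:
  "Edges es \<in> paths E \<longleftrightarrow> es \<noteq> [] \<and> set es \<subseteq> arcs E \<and>
     (\<forall>i. Suc i < length es \<longrightarrow> head E (es ! Suc i) = tail E (es ! i))"
  by (auto simp: paths_def)

lemma Edges_Cons_Cons_in_paths:
  "Edges (e # f # es) \<in> paths E \<longleftrightarrow> e \<in> arcs E \<and> head E f = tail E e \<and> Edges (f # es) \<in> paths E"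
  by (auto simp: Edges_in_paths nth_Cons' less_Suc_eq_0_disj split: if_splits)

lemma path_length_cons_path [simp]: "path_length (cons_path e \<mu>) = Suc (path_length \<mu>)"
  by (cases \<mu>) auto

lemma path_range_cons_path [simp]: "path_range E (cons_path e \<mu>) = head E e"
  by (cases \<mu>) auto

lemma path_weight_cons_path [simp]: "path_weight c (cons_path e \<mu>) = c e * path_weight c \<mu>"
  by (cases \<mu>) auto

context wf_digraph
begin

lemma cons_path_in_paths:
  assumes "e \<in> arcs G" "\<mu> \<in> paths G" "tail G e = path_range G \<mu>"
  shows "cons_path e \<mu> \<in> paths G"
proof (cases \<mu>)
  case (Vertex v)
  then show ?thesis using assms by (simp add: Edges_in_paths)
next
  case (Edges es)
  with assms(2) obtain f fs where "es = f # fs" by (cases es) (auto simp: Edges_in_paths)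
  then show ?thesis using assms Edges by (simp add: Edges_Cons_Cons_in_paths)
qed

lemma path_source_cons_path:
  assumes "\<mu> \<in> paths G" "tail G e = path_range G \<mu>"
  shows "path_source G (cons_path e \<mu>) = path_source G \<mu>"
  using assms by (cases \<mu>) (auto simp: Edges_in_paths)

text \<open>The tail conditions recover a vertex dropped by \<open>cons_path\<close>, and membership
  in \<open>paths\<close> excludes \<open>Edges []\<close> as a remainder.\<close>

lemma cons_path_eq_iff:
  assumes "\<mu> \<in> paths G" "tail G e = path_range G \<mu>" "\<nu> \<in> paths G" "tail G f = path_range G \<nu>"
  shows "cons_path e \<mu> = cons_path f \<nu> \<longleftrightarrow> e = f \<and> \<mu> = \<nu>"
  using assms by (cases \<mu>; cases \<nu>) (auto simp: Edges_in_paths)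

text \<open>Paths are split at the range end, matching the factorisation of \<open>path_elt\<close>.
  A single edge is the edge put before the vertex at its source, so length one needs no separate
  case later.\<close>

lemma paths_cases [consumes 1, case_names Vertex cons]:
  assumes "\<mu> \<in> paths G"
  obtains v where "v \<in> verts G" "\<mu> = Vertex v"
  | e \<nu> where "e \<in> arcs G" "\<nu> \<in> paths G" "tail G e = path_range G \<nu>" "\<mu> = cons_path e \<nu>"
proof (cases \<mu>)
  case (Vertex v)
  then show ?thesis using assms that(1) by simp
next
  case (Edges es)
  then consider e where "es = [e]" "e \<in> arcs G"
    | e f fs where "es = e # f # fs" "e \<in> arcs G" "head G f = tail G e" "Edges (f # fs) \<in> paths G"
    using assms by (cases es rule: list.exhaust; cases "tl es")
      (auto simp: Edges_Cons_Cons_in_paths Edges_in_paths[of "[_]"] Edges_in_paths[of "[]"])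
  then show ?thesis
  proof cases
    case 1
    then show ?thesis using Edges that(2)[of e "Vertex (tail G e)"] by simp
  next
    case 2
    then show ?thesis using Edges that(2)[of e "Edges (f # fs)"] by simp
  qed
qed

lemma paths_induct [consumes 1, case_names Vertex cons]:
  assumes "\<mu> \<in> paths G"
    and "\<And>v. v \<in> verts G \<Longrightarrow> P (Vertex v)"
    and "\<And>e \<mu>. e \<in> arcs G \<Longrightarrow> \<mu> \<in> paths G \<Longrightarrow> tail G e = path_range G \<mu> \<Longrightarrow> P \<mu> \<Longrightarrow> P (cons_path e \<mu>)"
  shows "P \<mu>"
  using assms(1)
\<comment> \<open>The length drops by one even when the remainder is a vertex, where the datatype
  constructor changes.\<close>
proof (induction "path_length \<mu>" arbitrary: \<mu>)
  case 0
  from 0(2) show ?case by (cases rule: paths_cases) (use 0(1) assms(2) in auto)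
next
  case (Suc n)
  from Suc.prems show ?case by (cases rule: paths_cases) (use Suc.hyps assms(3) in auto)
qed

lemma path_range_in_verts: "\<mu> \<in> paths G \<Longrightarrow> path_range G \<mu> \<in> verts G"
  by (induction rule: paths_induct) auto

lemma path_source_in_verts: "\<mu> \<in> paths G \<Longrightarrow> path_source G \<mu> \<in> verts G"
  by (induction rule: paths_induct) (auto simp: path_source_cons_path)

lemma path_weight_pos:
  assumes "\<mu> \<in> paths G" "\<forall>e\<in>arcs G. c e > 0"
  shows "path_weight c \<mu> > 0"
  using assms by (induction rule: paths_induct) auto

end

section \<open>The span of the monomials in a graph algebra\<close>

locale ck_family = wf_digraph E for E :: "('v, 'e) pre_digraph" +
  fixes p :: "'v \<Rightarrow> 'a::cstar_algebra" and s :: "'e \<Rightarrow> 'a"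
  assumes CK_family: "CK_family E type_cstar p s"
begin

lemma
  shows vertex_idem: "v \<in> verts E \<Longrightarrow> p v * p v = p v"
    and vertex_adj: "v \<in> verts E \<Longrightarrow> adj (p v) = p v"
    and vertex_orth: "v \<in> verts E \<Longrightarrow> w \<in> verts E \<Longrightarrow> v \<noteq> w \<Longrightarrow> p v * p w = 0"
    and edge_partial_isometry: "e \<in> arcs E \<Longrightarrow> s e * adj (s e) * s e = s e"
    and edge_orth: "e \<in> arcs E \<Longrightarrow> f \<in> arcs E \<Longrightarrow> e \<noteq> f \<Longrightarrow> (s e * adj (s e)) * (s f * adj (s f)) = 0"
    and edge_adj_mult: "e \<in> arcs E \<Longrightarrow> adj (s e) * s e = p (tail E e)"
    and edge_le: "e \<in> arcs E \<Longrightarrow> p (head E e) * (s e * adj (s e)) = s e * adj (s e)"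
  using CK_family
  by (simp_all add: CK_family_def type_cstar_def projection_def partial_isometry_def proj_le_def)

lemma edge_tail: "e \<in> arcs E \<Longrightarrow> s e * p (tail E e) = s e"
  by (metis edge_adj_mult edge_partial_isometry mult.assoc)

lemma edge_head: "e \<in> arcs E \<Longrightarrow> p (head E e) * s e = s e"
  by (metis edge_le edge_partial_isometry mult.assoc)

text \<open>Each partial isometry absorbs its own range projection, which brings the two orthogonal
  range projections next to each other.\<close>

lemma edge_adj_mult_distinct:
  assumes "e \<in> arcs E" "f \<in> arcs E" "e \<noteq> f"
  shows "adj (s e) * s f = 0"
proof -
  have "adj (s e) = adj (s e) * (s e * adj (s e))"
    by (metis adj_adj adj_mult assms(1) edge_partial_isometry mult.assoc)
  then have "adj (s e) * s f = adj (s e) * ((s e * adj (s e)) * (s f * adj (s f))) * s f"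
    by (metis assms(2) edge_partial_isometry mult.assoc)
  then show ?thesis by (simp only: edge_orth[OF assms] mult_zero_left mult_zero_right)
qed

abbreviation S :: "('v, 'e) gpath \<Rightarrow> 'a" where
  "S \<equiv> path_elt p s"

lemma S_cons_path:
  assumes "e \<in> arcs E" "\<mu> \<in> paths E" "tail E e = path_range E \<mu>"
  shows "S (cons_path e \<mu>) = s e * S \<mu>"
proof (cases \<mu>)
  case (Edges es)
  then show ?thesis using assms by (cases es) (auto simp: Edges_in_paths)
qed (use assms edge_tail[of e] in auto)

lemma S_range: "\<mu> \<in> paths E \<Longrightarrow> p (path_range E \<mu>) * S \<mu> = S \<mu>"
  by (cases rule: paths_cases) (auto simp: vertex_idem S_cons_path edge_head simp flip: mult.assoc)

lemma S_source: "\<mu> \<in> paths E \<Longrightarrow> S \<mu> * p (path_source E \<mu>) = S \<mu>"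
  by (induction rule: paths_induct) (auto simp: vertex_idem S_cons_path path_source_cons_path mult.assoc)

lemma vertex_mult_S:
  assumes "v \<in> verts E" "\<mu> \<in> paths E"
  shows "p v * S \<mu> = (if v = path_range E \<mu> then S \<mu> else 0)"
proof -
  have "p v * S \<mu> = p v * p (path_range E \<mu>) * S \<mu>"
    by (simp add: mult.assoc S_range[OF assms(2)])
  then show ?thesis
    using vertex_orth[OF assms(1) path_range_in_verts[OF assms(2)]] S_range[OF assms(2)] by auto
qed

text \<open>\<open>s e\<close> absorbs the projection at its tail, and this projection kills every
  path that \<open>e\<close> cannot precede.\<close>

lemma edge_mult_S:
  assumes "e \<in> arcs E" "\<mu> \<in> paths E"
  shows "s e * S \<mu> = (if tail E e = path_range E \<mu> then S (cons_path e \<mu>) else 0)"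
proof -
  have "s e * (p (tail E e) * S \<mu>) = s e * S \<mu>"
    using edge_tail[OF assms(1)] by (simp flip: mult.assoc)
  then show ?thesis using assms vertex_mult_S[of "tail E e" \<mu>] by (auto simp: S_cons_path)
qed

lemma edge_adj_mult_S_cons_path:
  assumes "e \<in> arcs E" "f \<in> arcs E" "\<mu> \<in> paths E" "tail E f = path_range E \<mu>"
  shows "adj (s e) * S (cons_path f \<mu>) = (if e = f then S \<mu> else 0)"
proof (cases "e = f")
  case True
  then have "adj (s e) * S (cons_path f \<mu>) = p (path_range E \<mu>) * S \<mu>"
    using assms edge_adj_mult[of e] by (simp add: S_cons_path flip: mult.assoc)
  then show ?thesis using True assms by (simp add: S_range)
next
  case False
  then show ?thesis
    using assms edge_adj_mult_distinct by (simp add: S_cons_path flip: mult.assoc)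
qed

lemma S_mult_edge:
  assumes "\<mu> \<in> paths E" "e \<in> arcs E" "path_source E \<mu> = head E e"
  obtains \<nu> where "\<nu> \<in> paths E" "S \<mu> * s e = S \<nu>" "path_source E \<nu> = tail E e"
    "path_length \<nu> = Suc (path_length \<mu>)"
proof -
  \<comment> \<open>The range of the extended path is added to the claim, so that the next edge can
    be put in front of it.\<close>
  have "\<exists>\<nu>\<in>paths E. S \<mu> * s e = S \<nu> \<and> path_source E \<nu> = tail E e \<and>
      path_length \<nu> = Suc (path_length \<mu>) \<and> path_range E \<nu> = path_range E \<mu>"
    using assms(1,3)
  proof (induction rule: paths_induct)
    case (Vertex v)
    show ?case
      by (rule bexI[of _ "cons_path e (Vertex (tail E e))"])
        (use Vertex assms(2) edge_head[of e] in \<open>auto intro: cons_path_in_paths simp: edge_head Edges_in_paths\<close>)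
  next
    case (cons f \<mu>)
    then obtain \<nu> where "\<nu> \<in> paths E" "S \<mu> * s e = S \<nu>" "path_source E \<nu> = tail E e"
      "path_length \<nu> = Suc (path_length \<mu>)" "path_range E \<nu> = path_range E \<mu>"
      by (auto simp: path_source_cons_path)
    then show ?case using cons.hyps
      by (intro bexI[of _ "cons_path f \<nu>"])
        (auto simp: S_cons_path path_source_cons_path cons_path_in_paths mult.assoc)
  qed
  then show ?thesis using that by blast
qed

lemma S_adj_mult_self: "\<mu> \<in> paths E \<Longrightarrow> adj (S \<mu>) * S \<mu> = p (path_source E \<mu>)"
proof (induction rule: paths_induct)
  case (cons e \<mu>)
  have "adj (S (cons_path e \<mu>)) * S (cons_path e \<mu>) = adj (S \<mu>) * (adj (s e) * S (cons_path e \<mu>))"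
    using cons.hyps by (simp add: S_cons_path adj_mult mult.assoc)
  then show ?case using cons by (simp add: edge_adj_mult_S_cons_path path_source_cons_path)
qed (simp add: vertex_adj vertex_idem)

text \<open>Common edges cancel one by one from the range end. Either two edges differ and the
  product vanishes, or \<open>\<nu>\<close> is used up and the rest of \<open>\<mu>\<close> remains
  as \<open>\<kappa>\<close>.\<close>

lemma S_adj_mult_distinct:
  assumes "\<nu> \<in> paths E" "\<mu> \<in> paths E" "\<nu> \<noteq> \<mu>" "path_length \<nu> \<le> path_length \<mu>"
  shows "adj (S \<nu>) * S \<mu> = 0 \<or>
    (\<exists>\<kappa>\<in>paths E. path_length \<kappa> > 0 \<and> path_length \<kappa> + path_length \<nu> = path_length \<mu> \<and> adj (S \<nu>) * S \<mu> = S \<kappa>)"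
  using assms
proof (induction arbitrary: \<mu> rule: paths_induct)
  case (Vertex v)
  show ?case
  proof (cases "v = path_range E \<mu>")
    case True
    \<comment> \<open>A path of length zero with range \<open>v\<close> would be
      \<open>Vertex v\<close> itself, so the remainder has positive length.\<close>
    from Vertex.prems(1) have "path_length \<mu> > 0"
      by (cases rule: paths_cases) (use Vertex.prems True in auto)
    moreover have "adj (S (Vertex v)) * S \<mu> = S \<mu>"
      using Vertex True by (simp add: vertex_adj S_range)
    ultimately show ?thesis using Vertex.prems(1) by (intro disjI2 bexI[of _ \<mu>]) simp_all
  qed (use Vertex in \<open>simp add: vertex_adj vertex_mult_S\<close>)
next
  case (cons e \<nu>)
  from cons.prems(1) obtain f \<kappa> where \<mu>: "f \<in> arcs E" "\<kappa> \<in> paths E" "tail E f = path_range E \<kappa>"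
    "\<mu> = cons_path f \<kappa>" by (cases rule: paths_cases) (use cons.prems(3) in auto)
  have eq: "adj (S (cons_path e \<nu>)) * S \<mu> = adj (S \<nu>) * (adj (s e) * S \<mu>)"
    using cons.hyps by (simp add: S_cons_path adj_mult mult.assoc)
  show ?case
  proof (cases "e = f")
    case True
    with cons.prems cons.hyps \<mu> have "\<nu> \<noteq> \<kappa>" "path_length \<nu> \<le> path_length \<kappa>"
      by auto
    note IH = cons.IH[OF \<mu>(2) this]
    have "adj (S (cons_path e \<nu>)) * S \<mu> = adj (S \<nu>) * S \<kappa>"
      unfolding eq using \<mu> cons.hyps(1) True by (simp add: edge_adj_mult_S_cons_path)
    then show ?thesis using IH \<mu>(4) by simp
  next
    case False
    have "adj (S (cons_path e \<nu>)) * S \<mu> = 0"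
      unfolding eq using \<mu> cons.hyps(1) False by (simp add: edge_adj_mult_S_cons_path)
    then show ?thesis by blast
  qed
qed

section \<open>The *-algebra spanned by the monomials\<close>

inductive_set monomials :: "'a set" where
  "\<mu> \<in> paths E \<Longrightarrow> \<nu> \<in> paths E \<Longrightarrow> path_source E \<mu> = path_source E \<nu> \<Longrightarrow>
    a *\<^sub>C (S \<mu> * adj (S \<nu>)) \<in> monomials"

text \<open>A complex subspace, since \<open>monomials\<close> is closed under complex multiples.\<close>

definition D :: "'a set" where "D = span monomials"

lemma D_zero [simp]: "0 \<in> D" and D_add: "x \<in> D \<Longrightarrow> y \<in> D \<Longrightarrow> x + y \<in> D"
  by (simp_all add: D_def span_zero span_add)

lemma monomial_in_D:
  "\<mu> \<in> paths E \<Longrightarrow> \<nu> \<in> paths E \<Longrightarrow> path_source E \<mu> = path_source E \<nu> \<Longrightarrow> S \<mu> * adj (S \<nu>) \<in> D"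
  unfolding D_def using monomials.intros[of \<mu> \<nu> 1] by (intro span_base) simp

text \<open>Stated for real linear maps, so that it covers the conjugate-linear \<open>adj\<close>
  along with scalar multiples, multiplications and the flow.\<close>

lemma linear_image_D:
  assumes "linear L" "\<And>x. x \<in> monomials \<Longrightarrow> L x \<in> D" "x \<in> D"
  shows "L x \<in> D"
  using assms(3) unfolding D_def
proof (induction rule: span_induct)
  show "subspace {x. L x \<in> span monomials}"
    using assms(1)
    by (simp add: subspace_def linear_0 linear_add linear_cmul span_zero span_add span_scale)
  show "L x \<in> span monomials" if "x \<in> monomials" for x using assms(2)[OF that] by (simp add: D_def)
qed

lemma D_scaleC: "x \<in> D \<Longrightarrow> a *\<^sub>C x \<in> D"
proof (rule linear_image_D[OF bounded_linear.linear[OF bounded_linear_scaleC]])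
  fix x assume "x \<in> monomials"
  then show "a *\<^sub>C x \<in> D"
    by cases (simp add: scaleC_scaleC D_def span_base monomials.intros)
qed

lemma D_adj: "x \<in> D \<Longrightarrow> adj x \<in> D"
proof (rule linear_image_D[OF bounded_linear.linear[OF bounded_linear_adj]])
  fix x assume "x \<in> monomials"
  then show "adj x \<in> D"
    by cases (simp add: adj_scaleC adj_mult adj_adj D_def span_base monomials.intros)
qed

lemma left_mult_D:
  assumes "\<And>\<mu> \<nu>. \<mu> \<in> paths E \<Longrightarrow> \<nu> \<in> paths E \<Longrightarrow> path_source E \<mu> = path_source E \<nu> \<Longrightarrow> x * (S \<mu> * adj (S \<nu>)) \<in> D"
    and "y \<in> D"
  shows "x * y \<in> D"
proof (rule linear_image_D[OF bounded_linear.linear[OF bounded_linear_mult_right] _ assms(2)])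
  fix y assume "y \<in> monomials"
  then show "x * y \<in> D" by cases (simp add: mult_scaleC_right D_scaleC assms(1))
qed

lemma vertex_mult_D: "v \<in> verts E \<Longrightarrow> y \<in> D \<Longrightarrow> p v * y \<in> D"
  by (rule left_mult_D) (simp_all add: vertex_mult_S monomial_in_D flip: mult.assoc)

lemma edge_mult_D: "e \<in> arcs E \<Longrightarrow> y \<in> D \<Longrightarrow> s e * y \<in> D"
  by (rule left_mult_D)
    (simp_all add: edge_mult_S monomial_in_D cons_path_in_paths path_source_cons_path flip: mult.assoc)

text \<open>If \<open>\<mu>\<close> has a first edge, it cancels or annihilates
  \<open>adj (s e)\<close>. If \<open>\<mu>\<close> is a vertex, the edge is absorbed on the other
  side, lengthening \<open>\<nu>\<close> at its source.\<close>

lemma edge_adj_mult_D: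
  assumes "e \<in> arcs E" "y \<in> D"
  shows "adj (s e) * y \<in> D"
  using assms(2)
proof (rule left_mult_D[rotated])
  fix \<mu> \<nu> assume h: "\<mu> \<in> paths E" "\<nu> \<in> paths E" "path_source E \<mu> = path_source E \<nu>"
  from h(1) show "adj (s e) * (S \<mu> * adj (S \<nu>)) \<in> D"
  proof (cases rule: paths_cases)
    case (Vertex v)
    have "adj (s e) * S \<mu> = adj (p v * p (head E e) * s e)"
      using Vertex assms(1) by (simp add: adj_mult vertex_adj edge_head mult.assoc)
    then have eq: "adj (s e) * S \<mu> = (if v = head E e then adj (s e) else 0)"
      using Vertex assms(1) by (simp add: vertex_idem vertex_orth edge_head)
    show ?thesis
    proof (cases "v = head E e")
      case True
      obtain \<kappa> where \<kappa>: "\<kappa> \<in> paths E" "S \<nu> * s e = S \<kappa>" "path_source E \<kappa> = tail E e"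
        using S_mult_edge[OF h(2) assms(1)] Vertex True h(3) by auto
      have "adj (s e) * (S \<mu> * adj (S \<nu>)) = adj (S \<kappa>)"
        using eq True by (simp add: adj_mult flip: \<kappa>(2) mult.assoc)
      \<comment> \<open>A monomial needs two paths with a common source; the vertex at the tail of
        \<open>e\<close> serves as the left one.\<close>
      also have "\<dots> = adj (S \<kappa> * S (Vertex (tail E e)))"
        using S_source[OF \<kappa>(1)] \<kappa>(3) by simp
      also have "\<dots> = S (Vertex (tail E e)) * adj (S \<kappa>)"
        using assms(1) by (simp add: adj_mult vertex_adj)
      finally show ?thesis using \<kappa> assms(1) monomial_in_D[of "Vertex (tail E e)" \<kappa>] by simp
    qed (use eq in \<open>simp flip: mult.assoc\<close>)
  next
    case (cons f \<kappa>)
    then show ?thesis using h assms(1)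
      by (auto simp: edge_adj_mult_S_cons_path path_source_cons_path monomial_in_D simp flip: mult.assoc)
  qed
qed

text \<open>The left factor is applied one generator at a time, which avoids a product formula for
  two monomials.\<close>

lemma D_mult:
  assumes "x \<in> D" "y \<in> D"
  shows "x * y \<in> D"
proof -
  have 1: "S \<mu> * z \<in> D" if "\<mu> \<in> paths E" "z \<in> D" for \<mu> z
    using that by (induction rule: paths_induct) (auto simp: vertex_mult_D S_cons_path mult.assoc edge_mult_D)
  have 2: "adj (S \<mu>) * z \<in> D" if "\<mu> \<in> paths E" "z \<in> D" for \<mu> z
    using that
  proof (induction arbitrary: z rule: paths_induct)
    case (cons e \<mu>)
    then show ?case by (simp add: S_cons_path adj_mult mult.assoc edge_adj_mult_D)
  qed (simp add: vertex_adj vertex_mult_D)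
  show ?thesis
  proof (rule linear_image_D[OF bounded_linear.linear[OF bounded_linear_mult_left] _ assms(1)])
    fix x assume "x \<in> monomials"
    then show "x * y \<in> D" by cases (simp add: mult_scaleC_left mult.assoc D_scaleC 1 2 assms(2))
  qed
qed

lemma star_subalgebra_D: "star_subalgebra D"
  by (simp add: star_subalgebra_def D_add D_mult D_adj D_scaleC)

lemma vertex_in_D: "v \<in> verts E \<Longrightarrow> p v \<in> D"
  using monomial_in_D[of "Vertex v" "Vertex v"] by (simp add: vertex_adj vertex_idem)

lemma S_in_D: "\<mu> \<in> paths E \<Longrightarrow> S \<mu> \<in> D"
  using monomial_in_D[of \<mu> "Vertex (path_source E \<mu>)"]
  by (simp add: vertex_adj S_source path_source_in_verts)

lemma edge_in_D:
  assumes "e \<in> arcs E"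
  shows "s e \<in> D"
  using S_in_D[of "cons_path e (Vertex (tail E e))"] assms cons_path_in_paths[of e "Vertex (tail E e)"]
  by simp

end

section \<open>Density and the approximate unit of vertex sums\<close>

locale graph_algebra = ck_family E p s
  for E :: "('v, 'e) pre_digraph" and p :: "'v \<Rightarrow> 'a::cstar_algebra" and s :: "'e \<Rightarrow> 'a" +
  assumes generates: "star_subalgebra A \<Longrightarrow> closed A \<Longrightarrow> p ` verts E \<subseteq> A \<Longrightarrow> s ` arcs E \<subseteq> A \<Longrightarrow> A = UNIV"
begin

lemma closure_D: "closure D = UNIV"
proof (rule generates)
  show "star_subalgebra (closure D)" by (rule star_subalgebra_closure[OF star_subalgebra_D])
  show "p ` verts E \<subseteq> closure D" "s ` arcs E \<subseteq> closure D"
    using closure_subset[of D] vertex_in_D edge_in_D by auto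
qed simp

text \<open>Agreement on a dense real span extends by continuity. The scalar stays inside the
  argument so that conjugate-linear maps can be compared too.\<close>

lemma bounded_linear_eqI:
  assumes f: "bounded_linear f" and g: "bounded_linear g"
    and eq: "\<And>\<mu> \<nu> a. \<mu> \<in> paths E \<Longrightarrow> \<nu> \<in> paths E \<Longrightarrow> path_source E \<mu> = path_source E \<nu> \<Longrightarrow>
      f (a *\<^sub>C (S \<mu> * adj (S \<nu>))) = g (a *\<^sub>C (S \<mu> * adj (S \<nu>)))"
  shows "f x = g x"
proof -
  have D: "f y = g y" if "y \<in> D" for y
    using bounded_linear.linear[OF f] bounded_linear.linear[OF g] _ that[unfolded D_def]
    by (rule linear_eq_on_span) (auto elim!: monomials.cases simp: eq)
  have "closed {y. f y = g y}"
    by (intro closed_Collect_eq linear_continuous_on f g)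
  then have "closure D \<subseteq> {y. f y = g y}" using D by (intro closure_minimal) auto
  then show ?thesis using closure_D by blast
qed

abbreviation P :: "'v set \<Rightarrow> 'a" where "P \<equiv> sum p"

lemma vertex_sum_projection:
  assumes "finite F" "F \<subseteq> verts E"
  shows "adj (P F) = P F" "P F * P F = P F" "norm (P F) \<le> 1"
proof -
  show 1: "adj (P F) = P F" unfolding adj_sum using assms(2) by (intro sum.cong) (auto simp: vertex_adj)
  have "P F * P F = (\<Sum>v\<in>F. \<Sum>w\<in>F. p v * p w)" by (simp add: sum_product)
  also have "\<dots> = (\<Sum>v\<in>F. \<Sum>w\<in>F. if v = w then p v else 0)"
    using assms(2) by (intro sum.cong) (auto simp: vertex_idem intro!: vertex_orth)
  also have "\<dots> = P F" using assms(1) by (intro sum.cong) auto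
  finally show 2: "P F * P F = P F" .
  have "(norm (P F))\<^sup>2 = norm (P F)" using cstar_identity[of "P F"] by (simp add: 1 2)
  then show "norm (P F) \<le> 1" by (cases "norm (P F) = 0") (auto simp: power2_eq_square)
qed

text \<open>A monomial is fixed as soon as the range of its left path belongs to the set. Demanding
  this for all larger sets lets finite sets be united for sums.\<close>

lemma vertex_sums_fix:
  assumes "x \<in> D"
  shows "\<exists>F. finite F \<and> F \<subseteq> verts E \<and> (\<forall>F'. finite F' \<and> F \<subseteq> F' \<and> F' \<subseteq> verts E \<longrightarrow> P F' * x = x)"
proof -
  define fixes_above where "fixes_above F x \<longleftrightarrow> finite F \<and> F \<subseteq> verts E \<and>
    (\<forall>F'. finite F' \<and> F \<subseteq> F' \<and> F' \<subseteq> verts E \<longrightarrow> P F' * x = x)" for F x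
  have "\<exists>F. fixes_above F x"
    using assms unfolding D_def
  proof (induction rule: span_induct)
    have "fixes_above (F \<union> G) (x + y)" if "fixes_above F x" "fixes_above G y" for F G x y
      using that by (simp add: fixes_above_def distrib_left)
    moreover have "fixes_above {} 0" by (simp add: fixes_above_def)
    moreover have "fixes_above F (r *\<^sub>R x)" if "fixes_above F x" for F r x
      using that by (simp add: fixes_above_def)
    ultimately show "subspace {x. \<exists>F. fixes_above F x}"
      unfolding subspace_def mem_Collect_eq by blast
  next
    fix x assume "x \<in> monomials"
    then obtain \<mu> \<nu> a where x: "x = a *\<^sub>C (S \<mu> * adj (S \<nu>))" "\<mu> \<in> paths E" by cases blast
    have "P F * x = x" if "finite F" "path_range E \<mu> \<in> F" "F \<subseteq> verts E" for F
    proof -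
      have "P F * S \<mu> = (\<Sum>v\<in>F. if v = path_range E \<mu> then S \<mu> else 0)"
        unfolding sum_distrib_right using that(3) x(2) by (intro sum.cong) (auto simp: vertex_mult_S)
      also have "\<dots> = S \<mu>" using that(1,2) by simp
      finally show ?thesis by (simp add: x(1) mult_scaleC_right flip: mult.assoc)
    qed
    then have "fixes_above {path_range E \<mu>} x"
      using path_range_in_verts[OF x(2)] by (simp add: fixes_above_def)
    then show "\<exists>F. fixes_above F x" ..
  qed
  then show ?thesis by (simp add: fixes_above_def)
qed

text \<open>Vertex sums are contractive, so being fixed exactly on the dense span becomes being
  fixed approximately everywhere.\<close>

lemma vertex_sums_approximate_unit:
  assumes "e > 0"
  obtains F where "finite F" "F \<subseteq> verts E"
    "\<And>F'. finite F' \<Longrightarrow> F \<subseteq> F' \<Longrightarrow> F' \<subseteq> verts E \<Longrightarrow> norm (P F' * x - x) < e"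
proof -
  have "x \<in> closure D" "e / 2 > 0" using closure_D assms by simp_all
  then obtain y where y: "y \<in> D" "norm (y - x) < e / 2"
    unfolding closure_approachable dist_norm by blast
  obtain F where F: "finite F" "F \<subseteq> verts E"
    "\<forall>F'. finite F' \<and> F \<subseteq> F' \<and> F' \<subseteq> verts E \<longrightarrow> P F' * y = y"
    using vertex_sums_fix[OF y(1)] by (elim exE conjE) (rule that)
  have "norm (P F' * x - x) < e" if F': "finite F'" "F \<subseteq> F'" "F' \<subseteq> verts E" for F'
  proof -
    have "P F' * x - x = (y - x) - P F' * (y - x)" using F(3) F' by (simp add: algebra_simps)
    then have "norm (P F' * x - x) \<le> norm (y - x) + norm (P F' * (y - x))"
      by (metis norm_triangle_ineq4)
    moreover have "norm (P F' * (y - x)) \<le> 1 * norm (y - x)"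
      by (intro order_trans[OF norm_mult_ineq] mult_right_mono vertex_sum_projection F') simp
    ultimately show ?thesis using y(2) by simp
  qed
  then show ?thesis using that F(1,2) by blast
qed

text \<open>If \<open>m\<close>, the modulus of the state at \<open>P F' * x\<close>, is near one,
  the projection estimate gives \<open>Re (\<phi> (P F')) \<ge> 2 - 1 / m\<^sup>2\<close>, which is
  also near one.\<close>

lemma state_on_vertex_sums:
  assumes "state_on UNIV \<phi>" "e > 0"
  obtains F where "finite F" "F \<subseteq> verts E"
    "\<And>F'. finite F' \<Longrightarrow> F \<subseteq> F' \<Longrightarrow> F' \<subseteq> verts E \<Longrightarrow> Re (\<phi> (P F')) \<ge> 1 - e"
proof -
  \<comment> \<open>Chosen so that \<open>2 - 1 / r\<^sup>2 = 1 - e\<close>.\<close>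
  define r where "r = sqrt (1 / (1 + e))"
  have r: "0 < r" "r < 1" "(1 + e) * r\<^sup>2 = 1" using assms(2) by (auto simp: r_def)
  \<comment> \<open>Half of the gap \<open>1 - r\<close>: one half is spent on choosing
    \<open>x\<close>, the other on approximating \<open>x\<close> by
    \<open>P F' * x\<close>.\<close>
  define d where "d = (1 - r) / 2"
  have d: "d > 0" "r = 1 - d - d" using r by (auto simp: d_def)
  obtain x where x: "norm x \<le> 1" "cmod (\<phi> x) > 1 - d"
    using state_on_approx[OF assms(1) _ d(1)] by auto
  obtain F where F: "finite F" "F \<subseteq> verts E"
    "\<And>F'. finite F' \<Longrightarrow> F \<subseteq> F' \<Longrightarrow> F' \<subseteq> verts E \<Longrightarrow> norm (P F' * x - x) < d"
    using vertex_sums_approximate_unit[OF d(1), of x] by blast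
  have "Re (\<phi> (P F')) \<ge> 1 - e" if F': "finite F'" "F \<subseteq> F'" "F' \<subseteq> verts E" for F'
  proof -
    define m where "m = cmod (\<phi> (P F' * x))"
    have "cmod (\<phi> (P F' * x) - \<phi> x) < d"
      using state_on_bound[OF assms(1), of "P F' * x - x"] F(3)[OF F']
      by (simp add: state_on_linear[OF assms(1)])
    then have "m \<ge> r" using x(2) norm_triangle_ineq2[of "\<phi> x" "\<phi> (P F' * x)"] d(2)
      by (simp add: m_def norm_minus_commute)
    then have m: "m\<^sup>2 \<ge> r\<^sup>2" "m\<^sup>2 > 0" using r(1) by (auto simp: power_mono)
    have "1 \<le> (1 + e) * m\<^sup>2"
      using mult_left_mono[OF m(1), of "1 + e"] r(3) assms(2) by simp
    moreover have "2 * m\<^sup>2 \<le> 1 + m\<^sup>2 * Re (\<phi> (P F'))"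
      unfolding m_def by (rule state_projection_estimate[OF assms(1) _ _ x(1)])
        (use vertex_sum_projection F' in auto)
    ultimately have "m\<^sup>2 * (1 - e) \<le> m\<^sup>2 * Re (\<phi> (P F'))" by (simp add: algebra_simps)
    then show ?thesis using m(2) by simp
  qed
  then show ?thesis using that F(1,2) by blast
qed

text \<open>The upper bound and positivity are immediate. For norm one, both states must be near one
  at the same element, and a large vertex sum provides it.\<close>

lemma state_on_convex_comb:
  fixes \<phi> \<psi> :: "'a \<Rightarrow> complex"
  assumes \<phi>: "state_on UNIV \<phi>" and \<psi>: "state_on UNIV \<psi>" and t: "t \<in> {0..1}"
  shows "state_on UNIV (convex_comb t \<phi> \<psi>)"
proof (rule state_onI)
  note lin = state_on_linear[OF \<phi>] state_on_linear[OF \<psi>]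
  show "convex_comb t \<phi> \<psi> (x + y) = convex_comb t \<phi> \<psi> x + convex_comb t \<phi> \<psi> y" for x y
    by (simp add: convex_comb_def lin algebra_simps)
  show "convex_comb t \<phi> \<psi> (a *\<^sub>C x) = a * convex_comb t \<phi> \<psi> x" for a x
    by (simp add: convex_comb_def lin algebra_simps)
  show "convex_comb t \<phi> \<psi> (adj x * x) \<in> \<real>\<^sub>\<ge>\<^sub>0" for x
  proof -
    have "complex_of_real t \<in> \<real>\<^sub>\<ge>\<^sub>0" "complex_of_real (1 - t) \<in> \<real>\<^sub>\<ge>\<^sub>0"
      using t by (simp_all del: of_real_diff)
    moreover have "\<phi> (adj x * x) \<in> \<real>\<^sub>\<ge>\<^sub>0" "\<psi> (adj x * x) \<in> \<real>\<^sub>\<ge>\<^sub>0"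
      using \<phi> \<psi> by (simp_all add: state_on_def)
    ultimately show ?thesis
      unfolding convex_comb_def by (intro nonneg_Reals_add_I nonneg_Reals_mult_I)
  qed
  show "cmod (convex_comb t \<phi> \<psi> x) \<le> 1" if x: "norm x \<le> 1" for x
  proof -
    have "cmod (convex_comb t \<phi> \<psi> x) \<le> t * cmod (\<phi> x) + (1 - t) * cmod (\<psi> x)"
      unfolding convex_comb_def using t norm_triangle_ineq[of "of_real t * \<phi> x" "of_real (1 - t) * \<psi> x"]
      by (simp add: norm_mult del: of_real_diff)
    also have "\<dots> \<le> t * 1 + (1 - t) * 1"
      using t by (intro add_mono mult_left_mono state_on_le_one[OF \<phi>] state_on_le_one[OF \<psi>] x) auto
    finally show ?thesis by simp
  qed
  show "\<exists>x\<in>UNIV. norm x \<le> 1 \<and> 1 - e \<le> cmod (convex_comb t \<phi> \<psi> x)" if "e > 0" for e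
  proof -
    obtain F where F: "finite F" "F \<subseteq> verts E"
      "\<And>F'. finite F' \<Longrightarrow> F \<subseteq> F' \<Longrightarrow> F' \<subseteq> verts E \<Longrightarrow> Re (\<phi> (P F')) \<ge> 1 - e"
      using state_on_vertex_sums[OF \<phi> \<open>e > 0\<close>] by blast
    obtain G where G: "finite G" "G \<subseteq> verts E"
      "\<And>F'. finite F' \<Longrightarrow> G \<subseteq> F' \<Longrightarrow> F' \<subseteq> verts E \<Longrightarrow> Re (\<psi> (P F')) \<ge> 1 - e"
      using state_on_vertex_sums[OF \<psi> \<open>e > 0\<close>] by blast
    \<comment> \<open>The union lies above both finite sets, so both lower bounds hold at
      once.\<close>
    define x where "x = P (F \<union> G)"
    have FG: "finite (F \<union> G)" "F \<union> G \<subseteq> verts E" using F G by auto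
    have x: "Re (\<phi> x) \<ge> 1 - e" "Re (\<psi> x) \<ge> 1 - e" using F(3)[of "F \<union> G"] G(3)[of "F \<union> G"] FG by (auto simp: x_def)
    have "t * (1 - e) + (1 - t) * (1 - e) \<le> t * Re (\<phi> x) + (1 - t) * Re (\<psi> x)"
      using t by (intro add_mono mult_left_mono x) auto
    also have "\<dots> = Re (convex_comb t \<phi> \<psi> x)" by (simp add: convex_comb_def)
    also have "\<dots> \<le> cmod (convex_comb t \<phi> \<psi> x)" by (rule complex_Re_le_cmod)
    finally have "1 - e \<le> cmod (convex_comb t \<phi> \<psi> x)" by (simp add: algebra_simps)
    then show ?thesis using vertex_sum_projection(3)[OF FG] by (auto simp: x_def)
  qed
qed

end

section \<open>KMS states of the weighted gauge dynamics\<close>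

locale graph_dynamics = graph_algebra E p s
  for E :: "('v, 'e) pre_digraph" and p :: "'v \<Rightarrow> 'a::cstar_algebra" and s :: "'e \<Rightarrow> 'a" +
  fixes c :: "'e \<Rightarrow> real" and \<beta> :: real and \<gamma> :: "complex \<Rightarrow> 'a \<Rightarrow> 'a"
    and \<sigma> :: "real \<Rightarrow> 'a \<Rightarrow> 'a" and \<Phi> :: "'a \<Rightarrow> 'a"
  assumes beta: "\<beta> > 0"
    and weight: "\<forall>e\<in>arcs E. c e > 0"
    and gauge: "gauge_action E p s \<gamma>"
    and dynamics: "weight_dynamics E p s c \<sigma>"
    and expectation: "core_expectation E p s \<gamma> \<Phi>"
    and no_unit_weight: "\<forall>\<mu>\<in>paths E - Vertex ` verts E. path_weight c \<mu> \<noteq> 1"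
begin

sublocale flow \<sigma>
  using dynamics by unfold_locales (simp_all add: weight_dynamics_def)

section \<open>Eigenvectors of the dynamics and values of KMS states\<close>

abbreviation W :: "('v, 'e) gpath \<Rightarrow> real" where "W \<equiv> path_weight c"

lemma W_pos: "\<mu> \<in> paths E \<Longrightarrow> W \<mu> > 0"
  by (rule path_weight_pos[OF _ weight])

lemma eigenvector_vertex: "v \<in> verts E \<Longrightarrow> eigenvector 0 (p v)"
  using dynamics by (simp add: weight_dynamics_def eigenvector_def)

lemma eigenvector_edge:
  assumes "e \<in> arcs E"
  shows "eigenvector (ln (c e)) (s e)"
proof -
  have "c e > 0" using assms weight by blast
  then have "complex_of_real (c e) powr (\<i> * complex_of_real t) = exp (\<i> * of_real (t * ln (c e)))" for t
    by (simp add: powr_def Ln_of_real mult.assoc)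
  then show ?thesis using dynamics assms by (simp add: weight_dynamics_def eigenvector_def)
qed

lemma eigenvector_S: "\<mu> \<in> paths E \<Longrightarrow> eigenvector (ln (W \<mu>)) (S \<mu>)"
proof (induction rule: paths_induct)
  case (cons e \<mu>)
  then have "c e > 0" using weight by blast
  with cons eigenvector_mult[OF eigenvector_edge[OF cons.hyps(1)] cons.IH] show ?case
    by (simp add: S_cons_path ln_mult_pos W_pos)
qed (simp add: eigenvector_vertex)

lemma monomial_eigenvector:
  assumes "x \<in> monomials"
  shows "\<exists>l. eigenvector l x"
  using assms
proof cases
  case (1 \<mu> \<nu> a)
  have "eigenvector (ln (W \<mu>) + - ln (W \<nu>)) (S \<mu> * adj (S \<nu>))"
    by (intro eigenvector_mult eigenvector_adj eigenvector_S 1)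
  then show ?thesis unfolding 1(1) by (intro exI eigenvector_scaleC)
qed

lemma exp_ln_W:
  "\<mu> \<in> paths E \<Longrightarrow> exp (- complex_of_real (\<beta> * ln (W \<mu>))) = of_real (W \<mu> powr (- \<beta>))"
  using W_pos[of \<mu>] by (simp add: powr_def exp_of_real[symmetric])

text \<open>For a state, condition \<open>(\<ast>)\<close> together with \<open>\<phi> = \<phi> \<circ> \<Phi>\<close>.\<close>

definition gibbs :: "('a \<Rightarrow> complex) \<Rightarrow> bool" where
  "gibbs \<phi> \<longleftrightarrow> (\<forall>\<mu>\<in>paths E. \<forall>\<nu>\<in>paths E. path_source E \<mu> = path_source E \<nu> \<longrightarrow>
     \<phi> (S \<mu> * adj (S \<nu>)) = (if \<mu> = \<nu> then of_real (W \<mu> powr (- \<beta>)) * \<phi> (p (path_source E \<mu>)) else 0))"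

lemma gibbsD:
  "gibbs \<phi> \<Longrightarrow> \<mu> \<in> paths E \<Longrightarrow> \<nu> \<in> paths E \<Longrightarrow> path_source E \<mu> = path_source E \<nu> \<Longrightarrow>
    \<phi> (S \<mu> * adj (S \<nu>)) = (if \<mu> = \<nu> then of_real (W \<mu> powr (- \<beta>)) * \<phi> (p (path_source E \<mu>)) else 0)"
  by (simp add: gibbs_def)

text \<open>The form in which the hypothesis on weights enters: the exchange factor of a path of
  positive length is never one.\<close>

lemma path_length_pos_weight:
  assumes "\<kappa> \<in> paths E" "path_length \<kappa> > 0"
  shows "ln (W \<kappa>) \<noteq> 0"
proof -
  have "\<kappa> \<notin> Vertex ` verts E" using assms(2) by auto
  then have "W \<kappa> \<noteq> 1" using assms(1) no_unit_weight by blast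
  then show ?thesis using W_pos[OF assms(1)] by simp
qed

text \<open>Exchange \<open>S \<kappa>\<close> with its source projection \<open>q\<close>. If
  \<open>\<kappa>\<close> is not closed, \<open>q * S \<kappa>\<close> is zero; if it is closed, the
  value equals itself times a factor different from one. The adjoint is treated likewise.\<close>

lemma KMS_S_zero:
  assumes KMS: "KMS_state \<sigma> \<beta> \<phi>" and \<kappa>: "\<kappa> \<in> paths E" "path_length \<kappa> > 0"
  shows "\<phi> (S \<kappa>) = 0" "\<phi> (adj (S \<kappa>)) = 0"
proof -
  have state: "state_on UNIV \<phi>" using KMS by (simp add: KMS_state_def)
  define q where "q = p (path_source E \<kappa>)"
  have src: "S \<kappa> * q = S \<kappa>" "adj q = q"
    using \<kappa>(1) by (simp_all add: q_def S_source vertex_adj path_source_in_verts)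
  have fixed: "z = 0" if "z = exp (- complex_of_real (\<beta> * l)) * z" "l \<noteq> 0" for z l
  proof (rule ccontr)
    assume "z \<noteq> 0"
    then have "exp (- complex_of_real (\<beta> * l)) = 1" using that(1) by simp
    then have "exp (- (\<beta> * l)) = 1" by (metis exp_of_real of_real_eq_1_iff of_real_minus)
    then show False using that(2) beta by simp
  qed
  have l: "ln (W \<kappa>) \<noteq> 0" "- ln (W \<kappa>) \<noteq> 0" using path_length_pos_weight[OF \<kappa>] by simp_all
  consider "q * S \<kappa> = S \<kappa>" | "q * S \<kappa> = 0"
    using vertex_mult_S[OF path_source_in_verts[OF \<kappa>(1)] \<kappa>(1)] by (auto simp: q_def split: if_splits)
  note cases = this
  have f1: "\<phi> (S \<kappa>) = exp (- complex_of_real (\<beta> * ln (W \<kappa>))) * \<phi> (q * S \<kappa>)"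
    using KMS_eigenvector[OF KMS beta eigenvector_S[OF \<kappa>(1)], of q] by (simp only: src)
  from cases show "\<phi> (S \<kappa>) = 0"
  proof cases
    case 1
    then show ?thesis using f1 fixed[OF _ l(1)] by simp
  next
    case 2
    then show ?thesis using f1 by (simp add: state_on_linear[OF state])
  qed
  have qa: "q * adj (S \<kappa>) = adj (S \<kappa>)" "adj (S \<kappa>) * q = adj (q * S \<kappa>)"
    using src by (simp_all add: adj_mult) (metis adj_mult)
  have f2: "\<phi> (adj (q * S \<kappa>)) = exp (- complex_of_real (\<beta> * - ln (W \<kappa>))) * \<phi> (adj (S \<kappa>))"
    using KMS_eigenvector[OF KMS beta eigenvector_adj[OF eigenvector_S[OF \<kappa>(1)]], of q] by (simp only: qa)
  from cases show "\<phi> (adj (S \<kappa>)) = 0"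
  proof cases
    case 1
    then show ?thesis using f2 fixed[OF _ l(2)] by simp
  next
    case 2
    then show ?thesis using f2 by (simp add: state_on_linear[OF state])
  qed
qed

lemma KMS_imp_gibbs:
  assumes KMS: "KMS_state \<sigma> \<beta> \<phi>"
  shows "gibbs \<phi>"
  unfolding gibbs_def
proof (intro ballI impI)
  fix \<mu> \<nu> assume \<mu>: "\<mu> \<in> paths E" and \<nu>: "\<nu> \<in> paths E" and src: "path_source E \<mu> = path_source E \<nu>"
  have state: "state_on UNIV \<phi>" using KMS by (simp add: KMS_state_def)
  have eq: "\<phi> (S \<mu> * adj (S \<nu>)) = of_real (W \<mu> powr (- \<beta>)) * \<phi> (adj (S \<nu>) * S \<mu>)"
    using KMS_eigenvector[OF KMS beta eigenvector_S[OF \<mu>], of "adj (S \<nu>)"] by (simp only: exp_ln_W[OF \<mu>])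
  have zero: "\<phi> (adj (S \<nu>) * S \<mu>) = 0" if ne: "\<mu> \<noteq> \<nu>"
  proof (cases "path_length \<nu> \<le> path_length \<mu>")
    case True
    with S_adj_mult_distinct[OF \<nu> \<mu>] ne show ?thesis
      by (auto simp: KMS_S_zero[OF KMS] state_on_linear[OF state])
  next
    case False
    then consider "adj (S \<mu>) * S \<nu> = 0" | \<kappa> where "\<kappa> \<in> paths E" "path_length \<kappa> > 0" "adj (S \<mu>) * S \<nu> = S \<kappa>"
      using S_adj_mult_distinct[OF \<mu> \<nu> ne] by auto
    \<comment> \<open>The cancellation lemma wants the shorter path on the left; taking adjoints
      swaps the two.\<close>
    moreover have "adj (S \<nu>) * S \<mu> = adj (adj (S \<mu>) * S \<nu>)" by (simp add: adj_mult adj_adj)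
    ultimately show ?thesis
      by cases (simp_all add: KMS_S_zero[OF KMS] state_on_linear[OF state])
  qed
  show "\<phi> (S \<mu> * adj (S \<nu>)) =
      (if \<mu> = \<nu> then of_real (W \<mu> powr (- \<beta>)) * \<phi> (p (path_source E \<mu>)) else 0)"
    using eq zero S_adj_mult_self[OF \<mu>] by (cases "\<mu> = \<nu>") simp_all
qed

section \<open>From the formula on monomials to the KMS condition\<close>

context
  fixes \<phi> :: "'a \<Rightarrow> complex"
  assumes state: "state_on UNIV \<phi>" and gibbs: "gibbs \<phi>"
begin

lemmas lin = state_on_linear[OF state]

lemma bounded_linear_left: "bounded_linear (\<lambda>y. \<phi> (x * y))"
  and bounded_linear_right: "bounded_linear (\<lambda>y. \<phi> (y * x))"
  by (rule bounded_linear_compose[OF lin(3)], rule bounded_linear_mult_right bounded_linear_mult_left)+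

text \<open>Both sides are conjugate linear, and on monomials the formula is symmetric in
  \<open>\<mu>\<close> and \<open>\<nu>\<close> with a real value.\<close>

lemma gibbs_adj: "\<phi> (adj x) = cnj (\<phi> x)"
proof (rule bounded_linear_eqI[of "\<lambda>x. \<phi> (adj x)" "\<lambda>x. cnj (\<phi> x)"])
  show "bounded_linear (\<lambda>x. \<phi> (adj x))" "bounded_linear (\<lambda>x. cnj (\<phi> x))"
    by (rule bounded_linear_compose[OF lin(3) bounded_linear_adj],
        rule bounded_linear_compose[OF bounded_linear_cnj lin(3)])
  fix \<mu> \<nu> a assume h: "\<mu> \<in> paths E" "\<nu> \<in> paths E" "path_source E \<mu> = path_source E \<nu>"
  have v: "cnj (\<phi> (p v)) = \<phi> (p v)" if "v \<in> verts E" for v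
  proof -
    have "\<phi> (adj (p v) * p v) \<in> \<real>\<^sub>\<ge>\<^sub>0" using state by (simp add: state_on_def)
    then show ?thesis using that
      by (simp add: vertex_adj vertex_idem complex_nonneg_Reals_iff complex_eq_iff)
  qed
  show "\<phi> (adj (a *\<^sub>C (S \<mu> * adj (S \<nu>)))) = cnj (\<phi> (a *\<^sub>C (S \<mu> * adj (S \<nu>))))"
    using gibbsD[OF gibbs h] gibbsD[OF gibbs h(2,1) h(3)[symmetric]] v[OF path_source_in_verts[OF h(1)]]
    by (cases "\<mu> = \<nu>") (simp_all add: adj_scaleC adj_mult adj_adj lin)
qed

text \<open>The KMS relation for one fixed \<open>x\<close>, with \<open>exp (- \<beta> * l)\<close>
  in place of the action of the flow at \<open>\<i> * \<beta>\<close>.\<close>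

definition exchange :: "real \<Rightarrow> 'a \<Rightarrow> bool" where
  "exchange l x \<longleftrightarrow> (\<forall>y. \<phi> (x * y) = exp (- complex_of_real (\<beta> * l)) * \<phi> (y * x))"

text \<open>First \<open>x\<close> and then \<open>y\<close> is moved cyclically to the right end,
  and the factors multiply.\<close>

lemma exchange_mult:
  assumes "exchange l x" "exchange m y"
  shows "exchange (l + m) (x * y)"
  unfolding exchange_def
proof
  fix z
  have "\<phi> (x * y * z) = exp (- complex_of_real (\<beta> * l)) * \<phi> (y * (z * x))"
    using assms(1) by (simp add: exchange_def mult.assoc)
  also have "\<phi> (y * (z * x)) = exp (- complex_of_real (\<beta> * m)) * \<phi> (z * (x * y))"
    using assms(2) by (simp add: exchange_def mult.assoc)
  finally show "\<phi> (x * y * z) = exp (- complex_of_real (\<beta> * (l + m))) * \<phi> (z * (x * y))"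
    by (simp add: ring_distribs mult.assoc flip: exp_add)
qed

text \<open>Conjugate the relation for \<open>x\<close> at \<open>adj y\<close>; the factor is real,
  so it survives and only has to be moved to the other side.\<close>

lemma exchange_adj:
  assumes "exchange l x"
  shows "exchange (- l) (adj x)"
  unfolding exchange_def
proof
  fix y
  have "\<phi> (x * adj y) = exp (- complex_of_real (\<beta> * l)) * \<phi> (adj y * x)"
    using assms by (simp add: exchange_def)
  then have "\<phi> (adj (x * adj y)) = exp (- complex_of_real (\<beta> * l)) * \<phi> (adj (adj y * x))"
    unfolding gibbs_adj by (simp add: exp_cnj)
  then have "\<phi> (y * adj x) = exp (- complex_of_real (\<beta> * l)) * \<phi> (adj x * y)"
    by (simp add: adj_mult adj_adj)
  then show "\<phi> (adj x * y) = exp (- complex_of_real (\<beta> * - l)) * \<phi> (y * adj x)"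
    by (simp flip: mult.assoc exp_add)
qed

text \<open>Left and right multiplication test the ranges of \<open>\<mu>\<close> and
  \<open>\<nu>\<close>, and only monomials with \<open>\<mu> = \<nu>\<close> have nonzero
  value.\<close>

lemma exchange_vertex:
  assumes v: "v \<in> verts E"
  shows "exchange 0 (p v)"
proof -
  have "\<phi> (p v * y) = \<phi> (y * p v)" for y
  proof (rule bounded_linear_eqI[OF bounded_linear_left bounded_linear_right])
    fix \<mu> \<nu> a assume h: "\<mu> \<in> paths E" "\<nu> \<in> paths E" "path_source E \<mu> = path_source E \<nu>"
    have left: "p v * (S \<mu> * adj (S \<nu>)) = (if v = path_range E \<mu> then S \<mu> * adj (S \<nu>) else 0)"
      using vertex_mult_S[OF v h(1)] by (simp flip: mult.assoc)
    have "(S \<mu> * adj (S \<nu>)) * p v = S \<mu> * adj (p v * S \<nu>)"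
      using v by (simp add: adj_mult vertex_adj mult.assoc)
    then have right: "(S \<mu> * adj (S \<nu>)) * p v = (if v = path_range E \<nu> then S \<mu> * adj (S \<nu>) else 0)"
      using vertex_mult_S[OF v h(2)] by simp
    show "\<phi> (p v * (a *\<^sub>C (S \<mu> * adj (S \<nu>)))) = \<phi> (a *\<^sub>C (S \<mu> * adj (S \<nu>)) * p v)"
      unfolding mult_scaleC_left mult_scaleC_right left right
      using gibbsD[OF gibbs h] by (cases "\<mu> = \<nu>") (simp_all add: lin)
  qed
  then show ?thesis by (simp add: exchange_def)
qed

text \<open>On a monomial, multiplying by \<open>s e\<close> from the left prepends \<open>e\<close>
  to \<open>\<mu>\<close>, and from the right removes \<open>e\<close> from \<open>\<nu>\<close>.
  Either value can be nonzero only if \<open>\<nu>\<close> is \<open>e\<close> followed by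
  \<open>\<mu>\<close>, and then the weights differ by the factor of \<open>c e\<close>.\<close>

lemma exchange_edge:
  assumes e: "e \<in> arcs E"
  shows "exchange (ln (c e)) (s e)"
proof -
  define r where "r = c e powr (- \<beta>)"
  have ce: "c e > 0" using e weight by blast
  have r: "exp (- complex_of_real (\<beta> * ln (c e))) = of_real r"
    using ce by (simp add: r_def powr_def exp_of_real[symmetric])
  have "\<phi> (s e * y) = of_real r * \<phi> (y * s e)" for y
  proof (rule bounded_linear_eqI[OF bounded_linear_left
        bounded_linear_const_mult[OF bounded_linear_right]])
    fix \<mu> \<nu> a assume h: "\<mu> \<in> paths E" "\<nu> \<in> paths E" "path_source E \<mu> = path_source E \<nu>"
    have left: "s e * (S \<mu> * adj (S \<nu>)) =
        (if tail E e = path_range E \<mu> then S (cons_path e \<mu>) * adj (S \<nu>) else 0)"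
      using edge_mult_S[OF e h(1)] by (simp flip: mult.assoc)
    have "\<phi> (s e * (S \<mu> * adj (S \<nu>))) = of_real r * \<phi> ((S \<mu> * adj (S \<nu>)) * s e)"
      using h(2)
    proof (cases rule: paths_cases)
      case (Vertex v)
      have L: "\<phi> (s e * (S \<mu> * adj (S \<nu>))) = 0"
      proof (cases "tail E e = path_range E \<mu>")
        case True
        have "cons_path e \<mu> \<noteq> \<nu>" using Vertex by (cases \<mu>) auto
        then show ?thesis
          using gibbsD[OF gibbs cons_path_in_paths[OF e h(1) True] h(2)] h True
          by (simp add: left path_source_cons_path)
      qed (simp add: left lin)
      have "(S \<mu> * adj (S \<nu>)) * s e = S \<mu> * (p v * s e)"
        using Vertex by (simp add: vertex_adj mult.assoc)
      \<comment> \<open>When \<open>e\<close> fits, the product is a path of positive length. Read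
        as a monomial with a vertex on the right it is off the diagonal.\<close>
      also have "\<phi> \<dots> = 0"
      proof (cases "v = head E e")
        case True
        then obtain \<kappa> where \<kappa>: "\<kappa> \<in> paths E" "S \<mu> * s e = S \<kappa>" "path_source E \<kappa> = tail E e"
          "path_length \<kappa> = Suc (path_length \<mu>)"
          using S_mult_edge[OF h(1) e] h(3) Vertex by auto
        have "S \<kappa> * adj (S (Vertex (tail E e))) = S \<kappa>"
          using S_source[OF \<kappa>(1)] \<kappa>(3) e by (simp add: vertex_adj)
        moreover have "\<kappa> \<noteq> Vertex (tail E e)" using \<kappa>(4) by auto
        ultimately have "\<phi> (S \<kappa>) = 0"
          using gibbsD[OF gibbs \<kappa>(1), of "Vertex (tail E e)"] \<kappa>(3) e by simp
        then show ?thesis using True \<kappa>(2) edge_head[OF e] by simp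
      next
        case False
        then have "p v * s e = p v * p (head E e) * s e"
          using edge_head[OF e] by (simp add: mult.assoc)
        then show ?thesis using vertex_orth[of v "head E e"] False Vertex e by (simp add: lin)
      qed
      finally show ?thesis using L by simp
    next
      case (cons f \<kappa>)
      have right: "(S \<mu> * adj (S \<nu>)) * s e = (if e = f then S \<mu> * adj (S \<kappa>) else 0)"
      proof -
        have "(S \<mu> * adj (S \<nu>)) * s e = S \<mu> * adj (adj (s e) * S (cons_path f \<kappa>))"
          using cons by (simp add: adj_mult adj_adj mult.assoc)
        then show ?thesis using edge_adj_mult_S_cons_path[OF e cons(1,2,3)] by simp
      qed
      have src: "path_source E \<mu> = path_source E \<kappa>"
        using h(3) cons by (simp add: path_source_cons_path)
      show ?thesis
      proof (cases "tail E e = path_range E \<mu>")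
        case True
        have iff: "cons_path e \<mu> = \<nu> \<longleftrightarrow> e = f \<and> \<mu> = \<kappa>"
          using cons_path_eq_iff[OF h(1) True cons(2,3)] cons(4) by simp
        have wt: "W (cons_path e \<mu>) powr (- \<beta>) = r * W \<mu> powr (- \<beta>)"
          using ce W_pos[OF h(1)] by (simp add: r_def powr_mult)
        have src': "path_source E (cons_path e \<mu>) = path_source E \<mu>"
          by (rule path_source_cons_path[OF h(1) True])
        have "\<phi> (S (cons_path e \<mu>) * adj (S \<nu>)) = (if e = f \<and> \<mu> = \<kappa>
            then of_real (r * W \<mu> powr (- \<beta>)) * \<phi> (p (path_source E \<mu>)) else 0)"
          using gibbsD[OF gibbs cons_path_in_paths[OF e h(1) True] h(2)] unfolding src' iff wt
          using h(3) by blast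
        moreover have "\<phi> (S \<mu> * adj (S \<kappa>)) = (if \<mu> = \<kappa>
            then of_real (W \<mu> powr (- \<beta>)) * \<phi> (p (path_source E \<mu>)) else 0)"
          by (rule gibbsD[OF gibbs h(1) cons(2) src])
        ultimately show ?thesis
          unfolding left right using True by (cases "e = f"; cases "\<mu> = \<kappa>") (simp_all add: lin)
      next
        case False
        then have "\<not> (e = f \<and> \<mu> = \<kappa>)" using cons(3) by auto
        then show ?thesis using False gibbsD[OF gibbs h(1) cons(2) src] by (simp add: left right lin)
      qed
    qed
    then show "\<phi> (s e * (a *\<^sub>C (S \<mu> * adj (S \<nu>)))) = of_real r * \<phi> (a *\<^sub>C (S \<mu> * adj (S \<nu>)) * s e)"
      by (simp add: mult_scaleC_left mult_scaleC_right lin)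
  qed
  then show ?thesis by (simp add: exchange_def r[simplified])
qed

lemma exchange_S: "\<mu> \<in> paths E \<Longrightarrow> exchange (ln (W \<mu>)) (S \<mu>)"
proof (induction rule: paths_induct)
  case (cons e \<mu>)
  then have "c e > 0" using weight by blast
  with cons exchange_mult[OF exchange_edge[OF cons.hyps(1)] cons.IH] show ?case
    by (simp add: S_cons_path ln_mult_pos W_pos)
qed (simp add: exchange_vertex)

text \<open>The span \<open>D\<close> serves as the dense subalgebra: on a monomial the flow and the
  exchange relation have the same exponent \<open>l\<close>, and both properties pass to
  sums.\<close>

lemma gibbs_imp_KMS: "KMS_state \<sigma> \<beta> \<phi>"
proof -
  \<comment> \<open>The extension and its KMS relation are bundled so that the induction over the
    span keeps one \<open>F\<close> for both.\<close>
  define kms_ext where "kms_ext x F \<longleftrightarrow> entire_extension \<sigma> x F \<and>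
    (\<forall>y. \<phi> (x * y) = \<phi> (y * F (\<i> * complex_of_real \<beta>)))" for x F
  have ext: "\<exists>F. kms_ext x F" if "x \<in> D" for x
    using that unfolding D_def
  proof (induction rule: span_induct)
    have "kms_ext 0 (\<lambda>_. 0)"
      using hom(2)[of _ 0 0] by (simp add: kms_ext_def entire_extension_def entire_zero)
    moreover have "kms_ext (x + y) (\<lambda>z. F z + G z)" if "kms_ext x F" "kms_ext y G" for x y F G
      using that by (simp add: kms_ext_def entire_extension_def entire_add hom lin ring_distribs)
    moreover have "kms_ext (r *\<^sub>R x) (\<lambda>z. r *\<^sub>R F z)" if x: "kms_ext x F" for x r F
    proof -
      have "entire (\<lambda>z. r *\<^sub>R F z)"
        by (rule entire_linear) (use x in \<open>auto simp: kms_ext_def entire_extension_def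
            scaleR_scaleC_commute intro: bounded_linear_scaleR_right\<close>)
      then show ?thesis using x
        by (simp add: kms_ext_def entire_extension_def scaleR_scaleC hom lin mult_scaleC_left mult_scaleC_right)
    qed
    ultimately show "subspace {x. \<exists>F. kms_ext x F}"
      unfolding subspace_def mem_Collect_eq by blast
  next
    fix x assume "x \<in> monomials"
    then obtain \<mu> \<nu> a where x: "x = a *\<^sub>C (S \<mu> * adj (S \<nu>))" "\<mu> \<in> paths E" "\<nu> \<in> paths E"
      by cases blast
    define l where "l = ln (W \<mu>) + - ln (W \<nu>)"
    have "eigenvector l (S \<mu> * adj (S \<nu>))" "exchange l (S \<mu> * adj (S \<nu>))"
      unfolding l_def using x
      by (intro eigenvector_mult eigenvector_adj eigenvector_S exchange_mult exchange_adj exchange_S; simp)+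
    then have "eigenvector l x" and ex: "exchange l x"
      unfolding x(1) by (simp_all add: eigenvector_def exchange_def hom scaleC_scaleC mult.commute
          mult_scaleC_left mult_scaleC_right lin)
    then have "kms_ext x (\<lambda>z. exp (\<i> * z * of_real l) *\<^sub>C x)"
      using eigenvector_entire_extension by (simp add: kms_ext_def exchange_def mult_scaleC_right lin mult.assoc[symmetric])
    then show "\<exists>F. kms_ext x F" by blast
  qed
  have rel: "\<phi> (x * y) = \<phi> (y * complex_flow \<sigma> (\<i> * complex_of_real \<beta>) x)" if "x \<in> D" for x y
    using ext[OF that] state_on_complex_flow[OF state] by (auto simp: kms_ext_def)
  have analytic: "entire_analytic \<sigma> x" if "x \<in> D" for x
    using ext[OF that] by (auto simp: kms_ext_def entire_analytic_def)
  have invariant: "\<sigma> t x \<in> D" if "x \<in> D" for t x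
  proof (rule linear_image_D[OF bounded_linear.linear[OF bounded_linear_flow] _ that])
    fix y assume y: "y \<in> monomials"
    then have "y \<in> D" by (simp add: D_def span_base)
    then show "\<sigma> t y \<in> D" using monomial_eigenvector[OF y] by (auto simp: eigenvector_def D_scaleC)
  qed
  show ?thesis
    unfolding KMS_state_def
    by (intro conjI exI[of _ D] ballI allI image_subsetI state star_subalgebra_D closure_D analytic
        invariant rel)
qed

end

lemma KMS_iff: "KMS_state \<sigma> \<beta> \<phi> \<longleftrightarrow> state_on UNIV \<phi> \<and> gibbs \<phi>"
  using KMS_imp_gibbs gibbs_imp_KMS by (auto simp: KMS_state_def)

end

section \<open>States on the core\<close>

context graph_dynamics
begin

abbreviation K :: "'a set" where "K \<equiv> core \<gamma>"

lemma core_closed: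
  "0 \<in> K" "x \<in> K \<Longrightarrow> y \<in> K \<Longrightarrow> x + y \<in> K" "x \<in> K \<Longrightarrow> a *\<^sub>C x \<in> K"
  "x \<in> K \<Longrightarrow> adj x * x \<in> K"
proof -
  have hom: "\<gamma> z (x + y) = \<gamma> z x + \<gamma> z y" "\<gamma> z (a *\<^sub>C x) = a *\<^sub>C \<gamma> z x" "\<gamma> z (x * y) = \<gamma> z x * \<gamma> z y"
    "\<gamma> z (adj x) = adj (\<gamma> z x)" if "z \<in> sphere 0 1" for z x y a
    using gauge that by (auto simp: gauge_action_def star_automorphism_def star_hom_type_cstar)
  show "0 \<in> K" using hom(2)[of _ 0 0] by (simp add: core_def)
  show "x \<in> K \<Longrightarrow> y \<in> K \<Longrightarrow> x + y \<in> K" "x \<in> K \<Longrightarrow> a *\<^sub>C x \<in> K" "x \<in> K \<Longrightarrow> adj x * x \<in> K"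
    by (simp_all add: core_def hom)
qed

lemma \<Phi>:
  "\<Phi> (x + y) = \<Phi> x + \<Phi> y" "\<Phi> (a *\<^sub>C x) = a *\<^sub>C \<Phi> x" "\<Phi> x \<in> K" "x \<in> K \<Longrightarrow> \<Phi> x = x"
  "norm (\<Phi> x) \<le> norm x" "\<exists>y\<in>K. \<Phi> (adj x * x) = adj y * y"
  using expectation by (auto simp: core_expectation_def conditional_expectation_def)

lemma bounded_linear_\<Phi>: "bounded_linear \<Phi>"
  by (rule bounded_linear_intro[where K = 1]) (simp_all add: \<Phi> scaleR_scaleC)

lemma \<Phi>_monomial:
  assumes "\<mu> \<in> paths E" "\<nu> \<in> paths E" "path_source E \<mu> = path_source E \<nu>"
  shows "\<Phi> (S \<mu> * adj (S \<nu>)) = (if path_length \<mu> = path_length \<nu> then S \<mu> * adj (S \<nu>) else 0)"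
  using expectation assms unfolding core_expectation_def by blast

lemma monomial_in_core:
  assumes "\<mu> \<in> paths E" "\<nu> \<in> paths E" "path_source E \<mu> = path_source E \<nu>" "path_length \<mu> = path_length \<nu>"
  shows "S \<mu> * adj (S \<nu>) \<in> K"
  using \<Phi>_monomial[OF assms(1-3)] \<Phi>(3)[of "S \<mu> * adj (S \<nu>)"] assms(4) by simp

lemma vertex_in_core: "v \<in> verts E \<Longrightarrow> p v \<in> K"
  using monomial_in_core[of "Vertex v" "Vertex v"] by (simp add: vertex_adj vertex_idem)

text \<open>The expectation changes only monomials of unequal lengths, and on those the formula
  already gives zero.\<close>

lemma gibbs_expectation:
  assumes state: "state_on UNIV \<phi>" and gibbs: "gibbs \<phi>"
  shows "\<phi> (\<Phi> x) = \<phi> x"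
proof (rule bounded_linear_eqI[OF bounded_linear_compose[OF _ bounded_linear_\<Phi>]])
  show "bounded_linear \<phi>" "bounded_linear \<phi>" by (rule state_on_linear[OF state])+
  fix \<mu> \<nu> a assume h: "\<mu> \<in> paths E" "\<nu> \<in> paths E" "path_source E \<mu> = path_source E \<nu>"
  show "\<phi> (\<Phi> (a *\<^sub>C (S \<mu> * adj (S \<nu>)))) = \<phi> (a *\<^sub>C (S \<mu> * adj (S \<nu>)))"
    unfolding \<Phi>(2) \<Phi>_monomial[OF h] state_on_linear(2)[OF state]
    using gibbsD[OF gibbs h] by (cases "\<mu> = \<nu>") (simp_all add: state_on_linear[OF state])
qed

text \<open>Since \<open>\<Phi>\<close> is contractive and preserves the state, it moves elements of
  nearly maximal value into the core.\<close>

lemma state_on_restrict: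
  assumes state: "state_on UNIV \<phi>" and \<phi>: "\<And>x. \<phi> (\<Phi> x) = \<phi> x"
  shows "state_on K (restrict \<phi> K)"
proof (rule state_onI)
  show "\<exists>x\<in>K. norm x \<le> 1 \<and> cmod (restrict \<phi> K x) \<ge> 1 - e" if e: "e > 0" for e
  proof -
    obtain x where "norm x \<le> 1" "cmod (\<phi> x) > 1 - e"
      using state_on_approx[OF state _ e] by auto
    then show ?thesis using \<Phi>(3,5)[of x] \<phi>[of x] by (intro bexI[of _ "\<Phi> x"]) auto
  qed
qed (use state state_on_le_one[OF state] in \<open>auto simp: core_closed state_on_def\<close>)

text \<open>Positivity comes from writing \<open>\<Phi> (adj x * x)\<close> as
  \<open>adj y * y\<close> with \<open>y\<close> in the core; norm one is inherited because
  \<open>\<Phi>\<close> fixes the core.\<close>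

lemma state_on_expectation:
  assumes state: "state_on K \<omega>"
  shows "state_on UNIV (\<omega> \<circ> \<Phi>)"
proof (rule state_onI)
  have add: "\<omega> (x + y) = \<omega> x + \<omega> y" if "x \<in> K" "y \<in> K" for x y
    using state that by (simp add: state_on_def)
  have scale: "\<omega> (a *\<^sub>C x) = a * \<omega> x" if "x \<in> K" for a x
    using state that by (simp add: state_on_def)
  have pos: "\<omega> (adj x * x) \<in> \<real>\<^sub>\<ge>\<^sub>0" if "x \<in> K" for x
    using state that by (simp add: state_on_def)
  show "(\<omega> \<circ> \<Phi>) (x + y) = (\<omega> \<circ> \<Phi>) x + (\<omega> \<circ> \<Phi>) y" for x y by (simp add: \<Phi> add)
  show "(\<omega> \<circ> \<Phi>) (a *\<^sub>C x) = a * (\<omega> \<circ> \<Phi>) x" for a x by (simp add: \<Phi> scale)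
  show "(\<omega> \<circ> \<Phi>) (adj x * x) \<in> \<real>\<^sub>\<ge>\<^sub>0" for x using \<Phi>(6)[of x] pos by auto
  show "cmod ((\<omega> \<circ> \<Phi>) x) \<le> 1" if "norm x \<le> 1" for x
    using that \<Phi>(3,5)[of x] by (auto intro!: state_on_le_one[OF state])
  show "\<exists>x\<in>UNIV. norm x \<le> 1 \<and> cmod ((\<omega> \<circ> \<Phi>) x) \<ge> 1 - e" if e: "e > 0" for e
  proof -
    obtain x where "x \<in> K" "norm x \<le> 1" "cmod (\<omega> x) > 1 - e"
      using state_on_approx[OF state core_closed(1) e] by auto
    then show ?thesis by (intro bexI[of _ x]) (simp_all add: \<Phi>(4))
  qed
qed

lemma core_condition_restrict:
  assumes "gibbs \<phi>"
  shows "core_condition E p s c \<beta> (restrict \<phi> K)"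
  unfolding core_condition_def
  using gibbsD[OF assms] monomial_in_core vertex_in_core path_source_in_verts by simp

lemma gibbs_compose:
  assumes state: "state_on K \<omega>" and cond: "core_condition E p s c \<beta> \<omega>"
  shows "gibbs (\<omega> \<circ> \<Phi>)"
  unfolding gibbs_def
proof (intro ballI impI)
  fix \<mu> \<nu> assume h: "\<mu> \<in> paths E" "\<nu> \<in> paths E" "path_source E \<mu> = path_source E \<nu>"
  have "\<omega> (0 *\<^sub>C 0) = 0 * \<omega> 0" using state core_closed(1) unfolding state_on_def by blast
  then have zero: "\<omega> 0 = 0" by simp
  have v: "\<Phi> (p (path_source E \<mu>)) = p (path_source E \<mu>)"
    by (intro \<Phi>(4) vertex_in_core path_source_in_verts h)
  show "(\<omega> \<circ> \<Phi>) (S \<mu> * adj (S \<nu>)) =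
      (if \<mu> = \<nu> then of_real (W \<mu> powr (- \<beta>)) * (\<omega> \<circ> \<Phi>) (p (path_source E \<mu>)) else 0)"
  proof (cases "path_length \<mu> = path_length \<nu>")
    case True
    have "\<omega> (S \<mu> * adj (S \<nu>)) =
        (if \<mu> = \<nu> then of_real (W \<mu> powr (- \<beta>)) * \<omega> (p (path_source E \<mu>)) else 0)"
      using cond h True unfolding core_condition_def by blast
    moreover have "\<Phi> (S \<mu> * adj (S \<nu>)) = S \<mu> * adj (S \<nu>)" using \<Phi>_monomial[OF h] True by simp
    ultimately show ?thesis by (simp only: o_apply v)
  next
    case False
    then show ?thesis using \<Phi>_monomial[OF h] zero by auto
  qed
qed

section \<open>The correspondence between KMS states and core states\<close>

lemma KMS_restrict:
  assumes "KMS_state \<sigma> \<beta> \<phi>"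
  shows "restrict \<phi> K \<in> core_states E p s c \<beta> \<gamma>" "restrict \<phi> K \<circ> \<Phi> = \<phi>"
proof -
  have \<phi>: "state_on UNIV \<phi>" "gibbs \<phi>" using assms by (simp_all add: KMS_iff)
  then show "restrict \<phi> K \<in> core_states E p s c \<beta> \<gamma>"
    by (simp add: core_states_def state_on_restrict gibbs_expectation core_condition_restrict)
  show "restrict \<phi> K \<circ> \<Phi> = \<phi>"
    by (rule ext) (simp add: \<Phi>(3) gibbs_expectation[OF \<phi>])
qed

lemma KMS_compose:
  assumes "state_on K \<omega>" "core_condition E p s c \<beta> \<omega>"
  shows "KMS_state \<sigma> \<beta> (\<omega> \<circ> \<Phi>)"
  using assms by (simp add: KMS_iff state_on_expectation gibbs_compose)

lemma restrict_compose:
  assumes "\<omega> \<in> core_states E p s c \<beta> \<gamma>"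
  shows "restrict (\<omega> \<circ> \<Phi>) K = \<omega>"
proof (rule extensionalityI[of _ K])
  show "\<omega> \<in> extensional K" using assms by (simp add: core_states_def)
qed (simp_all add: \<Phi>(4))

lemma KMS_convex_comb:
  assumes "KMS_state \<sigma> \<beta> \<phi>" "KMS_state \<sigma> \<beta> \<psi>" "t \<in> {0..1}"
  shows "KMS_state \<sigma> \<beta> (convex_comb t \<phi> \<psi>)"
  using assms state_on_convex_comb[of \<phi> \<psi> t]
  by (simp add: KMS_iff gibbs_def convex_comb_def algebra_simps)

text \<open>The combination is formed among KMS states on the whole algebra, where vertex sums give
  norm one, and is then restricted to the core.\<close>

lemma core_states_convex_comb:
  assumes "\<omega> \<in> core_states E p s c \<beta> \<gamma>" "\<omega>' \<in> core_states E p s c \<beta> \<gamma>" "t \<in> {0..1}"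
  shows "restrict (convex_comb t \<omega> \<omega>') K \<in> core_states E p s c \<beta> \<gamma>"
    and "restrict (convex_comb t \<omega> \<omega>') K \<circ> \<Phi> = convex_comb t (\<omega> \<circ> \<Phi>) (\<omega>' \<circ> \<Phi>)"
proof -
  show "restrict (convex_comb t \<omega> \<omega>') K \<circ> \<Phi> = convex_comb t (\<omega> \<circ> \<Phi>) (\<omega>' \<circ> \<Phi>)"
    by (rule ext) (simp add: convex_comb_def \<Phi>(3))
  have "KMS_state \<sigma> \<beta> (convex_comb t (\<omega> \<circ> \<Phi>) (\<omega>' \<circ> \<Phi>))"
    using assms by (intro KMS_convex_comb KMS_compose) (simp_all add: core_states_def)
  moreover have "restrict (convex_comb t (\<omega> \<circ> \<Phi>) (\<omega>' \<circ> \<Phi>)) K = restrict (convex_comb t \<omega> \<omega>') K"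
    by (rule restrict_ext) (simp add: convex_comb_def \<Phi>(4))
  ultimately show "restrict (convex_comb t \<omega> \<omega>') K \<in> core_states E p s c \<beta> \<gamma>"
    using KMS_restrict(1) by metis
qed

lemma bij_betw_KMS_core_states:
  "bij_betw (\<lambda>\<phi>. restrict \<phi> K) {\<phi>. KMS_state \<sigma> \<beta> \<phi>} (core_states E p s c \<beta> \<gamma>)"
proof (rule bij_betw_byWitness[where f' = "\<lambda>\<omega>. \<omega> \<circ> \<Phi>"])
  show "(\<lambda>\<omega>. \<omega> \<circ> \<Phi>) ` core_states E p s c \<beta> \<gamma> \<subseteq> {\<phi>. KMS_state \<sigma> \<beta> \<phi>}"
    by (auto simp: core_states_def intro: KMS_compose)
qed (auto simp: KMS_restrict restrict_compose)

end

theorem theorem3p3: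
  fixes E :: "('v, 'e) pre_digraph"
    and p :: "'v \<Rightarrow> 'a::cstar_algebra" and s :: "'e \<Rightarrow> 'a"
    and c :: "'e \<Rightarrow> real" and k \<beta> :: real
    and \<gamma> :: "complex \<Rightarrow> 'a \<Rightarrow> 'a" and \<sigma> :: "real \<Rightarrow> 'a \<Rightarrow> 'a" and \<Phi> :: "'a \<Rightarrow> 'a"
  assumes graph: "wf_digraph E" "verts E \<noteq> {}" "arcs E \<noteq> {}"
    and algebra: "graph_cstar_algebra E p s"
    and beta: "\<beta> > 0"
    and weight: "\<forall>e\<in>arcs E. c e > 0" "k > 0" "\<forall>e\<in>arcs E. c e > k"
    and gauge: "gauge_action E p s \<gamma>"
    and dynamics: "weight_dynamics E p s c \<sigma>"
    and expectation: "core_expectation E p s \<gamma> \<Phi>"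
    and no_unit_weight: "\<forall>\<mu>\<in>paths E - Vertex ` verts E. path_weight c \<mu> \<noteq> 1"
  shows
    "(\<forall>\<phi>. KMS_state \<sigma> \<beta> \<phi> \<longrightarrow> core_condition E p s c \<beta> (restrict \<phi> (core \<gamma>))) \<and>
     (\<forall>\<omega>. state_on (core \<gamma>) \<omega> \<and> core_condition E p s c \<beta> \<omega> \<longrightarrow> KMS_state \<sigma> \<beta> (\<omega> \<circ> \<Phi>)) \<and>
     bij_betw (\<lambda>\<phi>. restrict \<phi> (core \<gamma>)) {\<phi>. KMS_state \<sigma> \<beta> \<phi>} (core_states E p s c \<beta> \<gamma>) \<and>
     (\<forall>\<phi>. KMS_state \<sigma> \<beta> \<phi> \<longrightarrow> restrict \<phi> (core \<gamma>) \<circ> \<Phi> = \<phi>) \<and>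
     (\<forall>\<omega>\<in>core_states E p s c \<beta> \<gamma>. restrict (\<omega> \<circ> \<Phi>) (core \<gamma>) = \<omega>) \<and>
     (\<forall>\<phi> \<psi>. \<forall>t\<in>{0..1}. KMS_state \<sigma> \<beta> \<phi> \<and> KMS_state \<sigma> \<beta> \<psi> \<longrightarrow>
        KMS_state \<sigma> \<beta> (convex_comb t \<phi> \<psi>) \<and>
        restrict (convex_comb t \<phi> \<psi>) (core \<gamma>) =
          restrict (convex_comb t (restrict \<phi> (core \<gamma>)) (restrict \<psi> (core \<gamma>))) (core \<gamma>)) \<and>
     (\<forall>\<omega>\<in>core_states E p s c \<beta> \<gamma>. \<forall>\<omega>'\<in>core_states E p s c \<beta> \<gamma>. \<forall>t\<in>{0..1}.
        restrict (convex_comb t \<omega> \<omega>') (core \<gamma>) \<in> core_states E p s c \<beta> \<gamma> \<and>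
        restrict (convex_comb t \<omega> \<omega>') (core \<gamma>) \<circ> \<Phi> = convex_comb t (\<omega> \<circ> \<Phi>) (\<omega>' \<circ> \<Phi>))"
proof -
  interpret wf_digraph E by (rule graph)
  have generates: "A = UNIV"
    if "star_subalgebra A" "closed A" "p ` verts E \<subseteq> A" "s ` arcs E \<subseteq> A" for A
    using algebra that unfolding graph_cstar_algebra_def by blast
  interpret graph_dynamics E p s c \<beta> \<gamma> \<sigma> \<Phi>
    by unfold_locales
      (use algebra generates beta weight(1) gauge dynamics expectation no_unit_weight
        in \<open>simp_all add: graph_cstar_algebra_def\<close>)
  have "restrict (convex_comb t \<phi> \<psi>) K = restrict (convex_comb t (restrict \<phi> K) (restrict \<psi> K)) K" for t \<phi> \<psi>
    by (rule restrict_ext) (simp add: convex_comb_def)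
  moreover have "core_condition E p s c \<beta> (restrict \<phi> K)" if "KMS_state \<sigma> \<beta> \<phi>" for \<phi>
    using KMS_restrict(1)[OF that] by (simp add: core_states_def)
  ultimately show ?thesis
    by (intro conjI allI impI ballI)
      (simp_all only: KMS_compose bij_betw_KMS_core_states KMS_restrict(2) restrict_compose
        KMS_convex_comb core_states_convex_comb)
qed

end
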